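(* Let $R$ be a ring, $\mathfrak{a}$ an ideal of $R$, $\pi:R\to\overline{R}:=R/\mathfrak{a}$ the canonical map, and, for a subset $S$ of $R$, $\overline{S}:=\pi(S)$. (1) Let $(R,d)$ be a left (resp. right) Euclidean ring and $S\in\mathrm{Den}(R,\mathfrak{a})$. Then $(\overline{R},d_{\overline{R}})$ is a left (resp. right) Euclidean ring. Suppose that $d_{\overline{R}}(sr)=d_{\overline{R}}(rs)=d_{\overline{R}}(r)$ for all $s\in\overline{S}$ and $0\ne r\in\overline{R}$. Then the ring $S^{-1}R\simeq\overline{S}^{-1}\overline{R}\simeq\overline{R}\,\overline{S}^{-1}$ with the function $\delta$ is a left (resp. right) Euclidean ring, where $\delta(s^{-1}r):=d_{\overline{R}}(r)$ (resp. $\delta(rs^{-1}):=d_{\overline{R}}(r)$) for all $s\in\overline{S}$ and $0\ne r\in\overline{R}$. Furthermore, $\delta(rs^{-1})=d_{\overline{R}}(r)$ (resp. $\delta(s^{-1}r)=d_{\overline{R}}(r)$) for all $s\in\overline{S}$ and $0\neq r\in\overline{R}$. (2) Let $(R,d)$ be a left Euclidean ring and $S\in\mathrm{Den}_l(R,\mathfrak{a})$. Then $(\overline{R},d_{\overline{R}})$ is a left Euclidean ring. Suppose that $S$ is a right saturated left denominator set (that is, $st^{-1}\in\overline{R}$ with $s,t\in\overline{S}$ implies $st^{-1}\in\overline{S}$) and $d_{\overline{R}}(sr)=d_{\overline{R}}(r)$ for all $s\in\overline{S}$ and $0\neq r\in\overline{R}$. Then $(S^{-1}R,\delta)$ is a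 left Euclidean ring where $\delta(s^{-1}r):=d_{\overline{R}}(r)$ for all $s\in\overline{S}$ and $0\ne r\in\overline{R}$. (3) Let $(R,d)$ be a right Euclidean ring and $S\in\mathrm{Den}_r(R,\mathfrak{a})$. Then $(\overline{R},d_{\overline{R}})$ is a right Euclidean ring. Suppose that $S$ is a left saturated right denominator set (that is, $t^{-1}s\in\overline{R}$ with $s,t\in\overline{S}$ implies $t^{-1}s\in\overline{S}$) and $d_{\overline{R}}(rs)=d_{\overline{R}}(r)$ for all $s\in\overline{S}$ and $0\ne r\in\overline{R}$. Then $(\overline{R}\,\overline{S}^{-1},\delta)$ is a right Euclidean ring where $\delta(rs^{-1}):=d_{\overline{R}}(r)$ for all $s\in\overline{S}$ and $0\neq r\in\overline{R}$.
   Context: Rings are unital. A poset is Artinian if every descending chain in it stabilizes. A ring $R$ with a function $d:R\setminus\{0\}\to P$, $P$ a poset, is a left Euclidean ring if $\mathrm{im}(d)$ is an Artinian poset and, for any nonzero $u,v\in R$, there are $q,r\in R$ with $u=qv+r$ and either $r=0$ or $d(r)<d(v)$; it is a right Euclidean ring if the same holds with $u=vq+r$. (No assumption that $R$ is a domain.) For an ideal $\mathfrak{a}$, $d_{\overline{R}}(r+\mathfrak{a}):=\min\{d(r+a):a\in\mathfrak{a}\}$ for $r\notin\mathfrak{a}$ (least value; these minima are presupposed to exist). A multiplicative subset $S$ of $R$ ($SS\subseteq S$, $1\in S$, $0\notin S$) is a left Ore set if $Sr\cap Rs\neq\emptyset$ for all $r\in R$, $s\in S$; then $\mathrm{ass}_l(S):=\{r\in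 R: sr=0\text{ for some }s\in S\}$ is an ideal. A left Ore set $S$ is a left denominator set if $rs=0$ ($r\in R$, $s\in S$) implies $r\in\mathrm{ass}_l(S)$. $\mathrm{Den}_l(R,\mathfrak{a})$ is the set of left denominator sets $S$ with $\mathrm{ass}_l(S)=\mathfrak{a}$; $\mathrm{Den}_r(R,\mathfrak{a})$ is defined symmetrically using $\mathrm{ass}_r(S):=\{r:rs=0\text{ for some }s\in S\}$; $\mathrm{Den}(R,\mathfrak{a}):=\mathrm{Den}_l(R,\mathfrak{a})\cap\mathrm{Den}_r(R,\mathfrak{a})$. $S^{-1}R$ and $RS^{-1}$ are the left and right Ore localizations; $S^{-1}R\simeq\overline{S}^{-1}\overline{R}$ contains $\overline{R}$ as a subring when $S\in\mathrm{Den}_l(R,\mathfrak{a})$ (and similarly on the right). *)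

theory Defs
  imports "HOL-Algebra.QuotRing"
begin

section \<open>Euclidean rings\<close>

definition artinian_poset :: "'p::order set \<Rightarrow> bool" where
  "artinian_poset P \<longleftrightarrow>
     (\<forall>f :: nat \<Rightarrow> 'p. (\<forall>n. f n \<in> P) \<and> (\<forall>n. f (Suc n) \<le> f n) \<longrightarrow> (\<exists>N. \<forall>n\<ge>N. f n = f N))"

text \<open>The value of \<open>d\<close> at zero (and outside the carrier) is irrelevant in all the
  definitions below, so a total function stands for a function on the nonzero elements.\<close>

definition left_euclidean_ring :: "('a, 'm) ring_scheme \<Rightarrow> ('a \<Rightarrow> 'p::order) \<Rightarrow> bool" where
  "left_euclidean_ring R d \<longleftrightarrow> ring R \<and> artinian_poset (d ` (carrier R - {\<zero>\<^bsub>R\<^esub>})) \<and>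
     (\<forall>u \<in> carrier R - {\<zero>\<^bsub>R\<^esub>}. \<forall>v \<in> carrier R - {\<zero>\<^bsub>R\<^esub>}. \<exists>q \<in> carrier R. \<exists>r \<in> carrier R.
        u = q \<otimes>\<^bsub>R\<^esub> v \<oplus>\<^bsub>R\<^esub> r \<and> (r = \<zero>\<^bsub>R\<^esub> \<or> d r < d v))"

definition right_euclidean_ring :: "('a, 'm) ring_scheme \<Rightarrow> ('a \<Rightarrow> 'p::order) \<Rightarrow> bool" where
  "right_euclidean_ring R d \<longleftrightarrow> ring R \<and> artinian_poset (d ` (carrier R - {\<zero>\<^bsub>R\<^esub>})) \<and>
     (\<forall>u \<in> carrier R - {\<zero>\<^bsub>R\<^esub>}. \<forall>v \<in> carrier R - {\<zero>\<^bsub>R\<^esub>}. \<exists>q \<in> carrier R. \<exists>r \<in> carrier R.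
        u = v \<otimes>\<^bsub>R\<^esub> q \<oplus>\<^bsub>R\<^esub> r \<and> (r = \<zero>\<^bsub>R\<^esub> \<or> d r < d v))"

text \<open>On a nonzero coset the quotient function is the least value of \<open>d\<close>; in a
  partially ordered set it need not exist, whence the predicate \<open>has_quotient_minima\<close>.\<close>

definition quotient_fun :: "('a \<Rightarrow> 'p::order) \<Rightarrow> 'a set \<Rightarrow> 'p" where
  "quotient_fun d X = (LEAST p. p \<in> d ` X)"

definition has_quotient_minima ::
    "('a, 'm) ring_scheme \<Rightarrow> 'a set \<Rightarrow> ('a \<Rightarrow> 'p::order) \<Rightarrow> bool" where
  "has_quotient_minima R I d \<longleftrightarrow>
     (\<forall>X \<in> carrier (R Quot I) - {\<zero>\<^bsub>R Quot I\<^esub>}. \<exists>x\<in>X. \<forall>y\<in>X. d x \<le> d y)"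


section \<open>Denominator sets\<close>

definition multiplicative_subset :: "('a, 'm) ring_scheme \<Rightarrow> 'a set \<Rightarrow> bool" where
  "multiplicative_subset R S \<longleftrightarrow> S \<subseteq> carrier R \<and> \<one>\<^bsub>R\<^esub> \<in> S \<and> \<zero>\<^bsub>R\<^esub> \<notin> S \<and>
     (\<forall>s\<in>S. \<forall>t\<in>S. s \<otimes>\<^bsub>R\<^esub> t \<in> S)"

definition left_ore_set :: "('a, 'm) ring_scheme \<Rightarrow> 'a set \<Rightarrow> bool" where
  "left_ore_set R S \<longleftrightarrow> multiplicative_subset R S \<and>
     (\<forall>r \<in> carrier R. \<forall>s\<in>S. (S #>\<^bsub>R\<^esub> r) \<inter> (carrier R #>\<^bsub>R\<^esub> s) \<noteq> {})"

definition right_ore_set :: "('a, 'm) ring_scheme \<Rightarrow> 'a set \<Rightarrow> bool" where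
  "right_ore_set R S \<longleftrightarrow> multiplicative_subset R S \<and>
     (\<forall>r \<in> carrier R. \<forall>s\<in>S. (r <#\<^bsub>R\<^esub> S) \<inter> (s <#\<^bsub>R\<^esub> carrier R) \<noteq> {})"

definition ass_l :: "('a, 'm) ring_scheme \<Rightarrow> 'a set \<Rightarrow> 'a set" where
  "ass_l R S = {r \<in> carrier R. \<exists>s\<in>S. s \<otimes>\<^bsub>R\<^esub> r = \<zero>\<^bsub>R\<^esub>}"

definition ass_r :: "('a, 'm) ring_scheme \<Rightarrow> 'a set \<Rightarrow> 'a set" where
  "ass_r R S = {r \<in> carrier R. \<exists>s\<in>S. r \<otimes>\<^bsub>R\<^esub> s = \<zero>\<^bsub>R\<^esub>}"

definition left_denominator_set :: "('a, 'm) ring_scheme \<Rightarrow> 'a set \<Rightarrow> bool" where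
  "left_denominator_set R S \<longleftrightarrow> left_ore_set R S \<and>
     (\<forall>r \<in> carrier R. \<forall>s\<in>S. r \<otimes>\<^bsub>R\<^esub> s = \<zero>\<^bsub>R\<^esub> \<longrightarrow> r \<in> ass_l R S)"

definition right_denominator_set :: "('a, 'm) ring_scheme \<Rightarrow> 'a set \<Rightarrow> bool" where
  "right_denominator_set R S \<longleftrightarrow> right_ore_set R S \<and>
     (\<forall>r \<in> carrier R. \<forall>s\<in>S. s \<otimes>\<^bsub>R\<^esub> r = \<zero>\<^bsub>R\<^esub> \<longrightarrow> r \<in> ass_r R S)"

definition Den_l :: "('a, 'm) ring_scheme \<Rightarrow> 'a set \<Rightarrow> 'a set set" where
  "Den_l R I = {S. left_denominator_set R S \<and> ass_l R S = I}"

definition Den_r :: "('a, 'm) ring_scheme \<Rightarrow> 'a set \<Rightarrow> 'a set set" where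
  "Den_r R I = {S. right_denominator_set R S \<and> ass_r R S = I}"

definition Den :: "('a, 'm) ring_scheme \<Rightarrow> 'a set \<Rightarrow> 'a set set" where
  "Den R I = Den_l R I \<inter> Den_r R I"


section \<open>Ore localizations\<close>

text \<open>The pair \<open>(s, r)\<close> stands for the left fraction \<open>s\<^sup>-\<^sup>1 r\<close>. Two left fractions
  agree if they can be expanded to the same denominator in \<open>S\<close> and the same numerator.\<close>

definition lfrac_rel :: "('a, 'm) ring_scheme \<Rightarrow> 'a set \<Rightarrow> (('a \<times> 'a) \<times> ('a \<times> 'a)) set" where
  "lfrac_rel R S = {((s, r), (s', r')). s \<in> S \<and> s' \<in> S \<and> r \<in> carrier R \<and> r' \<in> carrier R \<and>
     (\<exists>c \<in> carrier R. \<exists>c' \<in> carrier R.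
        c \<otimes>\<^bsub>R\<^esub> s \<in> S \<and> c \<otimes>\<^bsub>R\<^esub> s = c' \<otimes>\<^bsub>R\<^esub> s' \<and> c \<otimes>\<^bsub>R\<^esub> r = c' \<otimes>\<^bsub>R\<^esub> r')}"

definition lfrac :: "('a, 'm) ring_scheme \<Rightarrow> 'a set \<Rightarrow> 'a \<Rightarrow> 'a \<Rightarrow> ('a \<times> 'a) set" where
  "lfrac R S s r = lfrac_rel R S `` {(s, r)}"

text \<open>The ring \<open>S\<^sup>-\<^sup>1 R\<close>. Product: if \<open>u r = b t\<close> with \<open>u \<in> S\<close>, then
  \<open>(s\<^sup>-\<^sup>1 r) (t\<^sup>-\<^sup>1 q) = (u s)\<^sup>-\<^sup>1 (b q)\<close>. Sum: if \<open>a s = b t \<in> S\<close>, then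
  \<open>s\<^sup>-\<^sup>1 r + t\<^sup>-\<^sup>1 q = (a s)\<^sup>-\<^sup>1 (a r + b q)\<close>. All admissible choices give the same class,
  so the unions below are this class.\<close>

definition left_localization :: "('a, 'm) ring_scheme \<Rightarrow> 'a set \<Rightarrow> ('a \<times> 'a) set ring" where
  "left_localization R S =
     \<lparr>carrier = (S \<times> carrier R) // lfrac_rel R S,
      mult = (\<lambda>X Y. \<Union>(s, r) \<in> X. \<Union>(t, q) \<in> Y.
        \<Union>{lfrac R S (u \<otimes>\<^bsub>R\<^esub> s) (b \<otimes>\<^bsub>R\<^esub> q) | u b.
            u \<in> S \<and> b \<in> carrier R \<and> u \<otimes>\<^bsub>R\<^esub> r = b \<otimes>\<^bsub>R\<^esub> t}),
      one = lfrac R S \<one>\<^bsub>R\<^esub> \<one>\<^bsub>R\<^esub>,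
      zero = lfrac R S \<one>\<^bsub>R\<^esub> \<zero>\<^bsub>R\<^esub>,
      add = (\<lambda>X Y. \<Union>(s, r) \<in> X. \<Union>(t, q) \<in> Y.
        \<Union>{lfrac R S (a \<otimes>\<^bsub>R\<^esub> s) (a \<otimes>\<^bsub>R\<^esub> r \<oplus>\<^bsub>R\<^esub> b \<otimes>\<^bsub>R\<^esub> q) | a b.
            a \<in> carrier R \<and> b \<in> carrier R \<and> a \<otimes>\<^bsub>R\<^esub> s \<in> S \<and> a \<otimes>\<^bsub>R\<^esub> s = b \<otimes>\<^bsub>R\<^esub> t})\<rparr>"

definition left_localization_map :: "('a, 'm) ring_scheme \<Rightarrow> 'a set \<Rightarrow> 'a \<Rightarrow> ('a \<times> 'a) set" where
  "left_localization_map R S r = lfrac R S \<one>\<^bsub>R\<^esub> r"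

definition opposite_ring :: "('a, 'm) ring_scheme \<Rightarrow> ('a, 'm) ring_scheme" where
  "opposite_ring R = R\<lparr>mult := \<lambda>x y. y \<otimes>\<^bsub>R\<^esub> x\<rparr>"

text \<open>The ring \<open>R S\<^sup>-\<^sup>1\<close>; here the class of the pair \<open>(s, r)\<close> is the right fraction
  \<open>r s\<^sup>-\<^sup>1\<close>.\<close>

definition right_localization :: "('a, 'm) ring_scheme \<Rightarrow> 'a set \<Rightarrow> ('a \<times> 'a) set ring" where
  "right_localization R S = opposite_ring (left_localization (opposite_ring R) S)"

definition right_localization_map :: "('a, 'm) ring_scheme \<Rightarrow> 'a set \<Rightarrow> 'a \<Rightarrow> ('a \<times> 'a) set" where
  "right_localization_map R S = left_localization_map (opposite_ring R) S"

text \<open>The embedding of \<open>R Quot ass_l R S\<close> into \<open>S\<^sup>-\<^sup>1 R\<close> induced by the canonical map, which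
  is constant on each coset.\<close>

definition left_localization_quot_map ::
    "('a, 'm) ring_scheme \<Rightarrow> 'a set \<Rightarrow> 'a set \<Rightarrow> ('a \<times> 'a) set" where
  "left_localization_quot_map R S X = the_elem (left_localization_map R S ` X)"

text \<open>For a map \<open>j\<close> of a ring \<open>A\<close> into a ring \<open>Q\<close> sending \<open>s\<close> to a unit, these are the
  elements \<open>s\<^sup>-\<^sup>1 r\<close> and \<open>r s\<^sup>-\<^sup>1\<close> of \<open>Q\<close>.\<close>

definition left_fraction :: "('q, 'm) ring_scheme \<Rightarrow> ('b \<Rightarrow> 'q) \<Rightarrow> 'b \<Rightarrow> 'b \<Rightarrow> 'q" where
  "left_fraction Q j s r = inv\<^bsub>Q\<^esub> (j s) \<otimes>\<^bsub>Q\<^esub> j r"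

definition right_fraction :: "('q, 'm) ring_scheme \<Rightarrow> ('b \<Rightarrow> 'q) \<Rightarrow> 'b \<Rightarrow> 'b \<Rightarrow> 'q" where
  "right_fraction Q j r s = j r \<otimes>\<^bsub>Q\<^esub> inv\<^bsub>Q\<^esub> (j s)"

definition right_saturated ::
    "('b, 'n) ring_scheme \<Rightarrow> 'b set \<Rightarrow> ('q, 'm) ring_scheme \<Rightarrow> ('b \<Rightarrow> 'q) \<Rightarrow> bool" where
  "right_saturated A T Q j \<longleftrightarrow>
     (\<forall>s\<in>T. \<forall>t\<in>T. right_fraction Q j s t \<in> j ` carrier A \<longrightarrow> right_fraction Q j s t \<in> j ` T)"

definition left_saturated ::
    "('b, 'n) ring_scheme \<Rightarrow> 'b set \<Rightarrow> ('q, 'm) ring_scheme \<Rightarrow> ('b \<Rightarrow> 'q) \<Rightarrow> bool" where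
  "left_saturated A T Q j \<longleftrightarrow>
     (\<forall>s\<in>T. \<forall>t\<in>T. left_fraction Q j t s \<in> j ` carrier A \<longrightarrow> left_fraction Q j t s \<in> j ` T)"


section \<open>The localization at a left denominator set is a ring of fractions\<close>

lemma Union_const:
  assumes "\<And>s r t q u b. (s,r) \<in> X \<Longrightarrow> (t,q) \<in> Y \<Longrightarrow> P s r t q u b \<Longrightarrow> f s r t q u b = Z"
    and "(s0,r0) \<in> X" "(t0,q0) \<in> Y" "P s0 r0 t0 q0 u0 b0"
  shows "(\<Union>(s, r) \<in> X. \<Union>(t, q) \<in> Y. \<Union>{f s r t q u b | u b. P s r t q u b}) = Z"
proof (rule equalityI; rule subsetI)
  fix z assume "z \<in> (\<Union>(s, r) \<in> X. \<Union>(t, q) \<in> Y. \<Union>{f s r t q u b | u b. P s r t q u b})"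
  then obtain s r t q u b where "(s,r) \<in> X" "(t,q) \<in> Y" "P s r t q u b" "z \<in> f s r t q u b" by blast
  then show "z \<in> Z" using assms(1) by metis
next
  fix z assume "z \<in> Z"
  then have "z \<in> f s0 r0 t0 q0 u0 b0" using assms by metis
  then show "z \<in> (\<Union>(s, r) \<in> X. \<Union>(t, q) \<in> Y. \<Union>{f s r t q u b | u b. P s r t q u b})" using assms(2-4) by blast
qed

locale left_den = ring R for R (structure) + fixes S
  assumes den: "left_denominator_set R S"
begin

lemma S_sub: "s \<in> S \<Longrightarrow> s \<in> carrier R"
  and S_one: "\<one> \<in> S" and S_mult: "s \<in> S \<Longrightarrow> t \<in> S \<Longrightarrow> s \<otimes> t \<in> S"
  using den unfolding left_denominator_set_def left_ore_set_def multiplicative_subset_def by auto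

lemma ore: 
  assumes "r \<in> carrier R" "s \<in> S"
  obtains u b where "u \<in> S" "b \<in> carrier R" "u \<otimes> r = b \<otimes> s"
proof -
  have "(S #> r) \<inter> (carrier R #> s) \<noteq> {}"
    using den assms unfolding left_denominator_set_def left_ore_set_def by auto
  then show ?thesis using that unfolding r_coset_def by auto
qed

lemma canc:
  assumes "c \<in> carrier R" "c' \<in> carrier R" "s \<in> S" "c \<otimes> s = c' \<otimes> s"
  obtains t where "t \<in> S" "t \<otimes> c = t \<otimes> c'"
proof -
  have "(c \<ominus> c') \<otimes> s = \<zero>"
    using assms S_sub by (simp add: a_minus_def l_distr l_minus r_neg)
  then have "c \<ominus> c' \<in> ass_l R S" 
    using den assms unfolding left_denominator_set_def by auto
  then obtain t where t: "t \<in> S" "t \<otimes> (c \<ominus> c') = \<zero>" unfolding ass_l_def by auto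
  then have "t \<otimes> c = t \<otimes> c'" 
    using assms S_sub[OF t(1)] by (simp add: a_minus_def r_distr r_minus) (metis m_closed minus_equality minus_minus a_inv_closed)
  then show ?thesis using t that by auto
qed

abbreviation (input) rel (infix "\<sim>" 50) where "p \<sim> q \<equiv> (p, q) \<in> lfrac_rel R S"
abbreviation (input) F where "F s r \<equiv> lfrac R S s r"
abbreviation (input) Q where "Q \<equiv> left_localization R S"

lemma relI:
  assumes "s \<in> S" "s' \<in> S" "r \<in> carrier R" "r' \<in> carrier R" "c \<in> carrier R" "c' \<in> carrier R"
   "c \<otimes> s \<in> S" "c \<otimes> s = c' \<otimes> s'" "c \<otimes> r = c' \<otimes> r'"
  shows "(s,r) \<sim> (s',r')"
  unfolding lfrac_rel_def mem_Collect_eq prod.case using assms by blast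

lemma relD:
  assumes "(s,r) \<sim> (s',r')"
  obtains c c' where "s \<in> S" "s' \<in> S" "r \<in> carrier R" "r' \<in> carrier R" "c \<in> carrier R" "c' \<in> carrier R"
   "c \<otimes> s \<in> S" "c \<otimes> s = c' \<otimes> s'" "c \<otimes> r = c' \<otimes> r'"
  using assms unfolding lfrac_rel_def by auto

text \<open>Equality of fractions can be tested on any common denominator.\<close>
lemma rel_any:
  assumes r: "(s,r) \<sim> (s',r')" and ab: "a \<in> carrier R" "b \<in> carrier R" "a \<otimes> s \<in> S" "a \<otimes> s = b \<otimes> s'"
  obtains t where "t \<in> S" "t \<otimes> (a \<otimes> r) = t \<otimes> (b \<otimes> r')"
proof -
  obtain c c' where c: "s \<in> S" "s' \<in> S" "r \<in> carrier R" "r' \<in> carrier R" "c \<in> carrier R" "c' \<in> carrier R"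
   "c \<otimes> s \<in> S" "c \<otimes> s = c' \<otimes> s'" "c \<otimes> r = c' \<otimes> r'" using relD[OF r] by metis
  note cl = c(1,2)[THEN S_sub] c(3-6) ab(1,2)
  obtain u v where u: "u \<in> S" "v \<in> carrier R" "u \<otimes> (a \<otimes> s) = v \<otimes> (c \<otimes> s)"
    using ore[of "a \<otimes> s" "c \<otimes> s"] c ab S_sub by blast
  note cu = S_sub[OF u(1)] u(2)
  obtain w where w: "w \<in> S" "w \<otimes> (u \<otimes> a) = w \<otimes> (v \<otimes> c)"
    using canc[of "u \<otimes> a" "v \<otimes> c" s] u(3) cl cu c(1) by (metis m_assoc m_closed)
  have "u \<otimes> (b \<otimes> s') = v \<otimes> (c' \<otimes> s')" using u(3) ab(4) c(8) by simp
  then obtain w' where w': "w' \<in> S" "w' \<otimes> (u \<otimes> b) = w' \<otimes> (v \<otimes> c')"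
    using canc[of "u \<otimes> b" "v \<otimes> c'" s'] cl cu c(2) by (metis m_assoc m_closed)
  obtain x y where x: "x \<in> S" "y \<in> carrier R" "x \<otimes> w = y \<otimes> w'"
    using ore[of w w'] w w' S_sub by blast
  define z where "z = x \<otimes> w"
  have z: "z \<in> S" unfolding z_def using x w S_mult by blast
  note cz = S_sub[OF z] S_sub[OF x(1)] x(2) S_sub[OF w(1)] S_sub[OF w'(1)]
  have 1: "z \<otimes> (u \<otimes> a) = z \<otimes> (v \<otimes> c)" unfolding z_def using w(2) cz cl cu by (simp add: m_assoc)
  have 2: "z \<otimes> (u \<otimes> b) = z \<otimes> (v \<otimes> c')" unfolding z_def x(3) using w'(2) cz cl cu by (simp add: m_assoc)
  have "(z \<otimes> u) \<otimes> (a \<otimes> r) = (z \<otimes> (u \<otimes> a)) \<otimes> r" using cz cl cu by (simp add: m_assoc)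
  also have "\<dots> = (z \<otimes> v) \<otimes> (c \<otimes> r)" unfolding 1 using cz cl cu by (simp add: m_assoc)
  also have "\<dots> = (z \<otimes> (v \<otimes> c')) \<otimes> r'" unfolding c(9) using cz cl cu by (simp add: m_assoc)
  also have "\<dots> = (z \<otimes> u) \<otimes> (b \<otimes> r')" unfolding 2[symmetric] using cz cl cu by (simp add: m_assoc)
  finally show ?thesis using that S_mult[OF z u(1)] by blast
qed

lemma rel_by:
  assumes "s \<in> S" "s' \<in> S" "r \<in> carrier R" "r' \<in> carrier R"
    and ab: "a \<in> carrier R" "b \<in> carrier R" "a \<otimes> s \<in> S" "a \<otimes> s = b \<otimes> s'"
    and t: "t \<in> S" "t \<otimes> (a \<otimes> r) = t \<otimes> (b \<otimes> r')"
  shows "(s,r) \<sim> (s',r')"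
  apply (rule relI[of s s' r r' "t \<otimes> a" "t \<otimes> b"])
  using assms S_mult[OF t(1) ab(3)] S_sub by (auto simp: m_assoc)

lemma expand: "s \<in> S \<Longrightarrow> r \<in> carrier R \<Longrightarrow> a \<in> carrier R \<Longrightarrow> a \<otimes> s \<in> S \<Longrightarrow> (s,r) \<sim> (a \<otimes> s, a \<otimes> r)"
  by (rule relI[where c=a and c'=\<one>]) (auto simp: S_sub)

lemma common:
  assumes "s \<in> S" "s' \<in> S"
  obtains a b where "a \<in> S" "b \<in> carrier R" "a \<otimes> s \<in> S" "a \<otimes> s = b \<otimes> s'"
  using ore[of s s'] assms S_sub S_mult by metis

lemma equiv_rel: "equiv (S \<times> carrier R) (lfrac_rel R S)"
proof (rule equivI)
  show "lfrac_rel R S \<subseteq> (S \<times> carrier R) \<times> (S \<times> carrier R)" unfolding lfrac_rel_def by auto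
  show "refl_on (S \<times> carrier R) (lfrac_rel R S)"
    unfolding refl_on_def using relI[where c=\<one> and c'=\<one>] S_sub by auto
  show "sym (lfrac_rel R S)"
  proof (rule symI, clarify)
    fix s r s' r' assume "(s,r) \<sim> (s',r')"
    then obtain c c' where c: "s \<in> S" "s' \<in> S" "r \<in> carrier R" "r' \<in> carrier R" "c \<in> carrier R" "c' \<in> carrier R"
     "c \<otimes> s \<in> S" "c \<otimes> s = c' \<otimes> s'" "c \<otimes> r = c' \<otimes> r'" using relD by metis
    show "(s',r') \<sim> (s,r)" by (rule relI[of s' s r' r c' c]) (use c in auto)
  qed
  show "trans (lfrac_rel R S)"
  proof (rule transI, clarify)
    fix s r s' r' s'' r'' assume 1: "(s,r) \<sim> (s',r')" and 2: "(s',r') \<sim> (s'',r'')"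
    have m: "s \<in> S" "s' \<in> S" "s'' \<in> S" "r \<in> carrier R" "r' \<in> carrier R" "r'' \<in> carrier R"
      using 1 2 unfolding lfrac_rel_def by auto
    obtain a b where ab: "a \<in> S" "b \<in> carrier R" "a \<otimes> s \<in> S" "a \<otimes> s = b \<otimes> s'" using common m by metis
    obtain e f where ef: "e \<in> S" "f \<in> carrier R" "e \<otimes> (a \<otimes> s) \<in> S" "e \<otimes> (a \<otimes> s) = f \<otimes> s''" 
      using common ab m by metis
    note cl = m(1-3)[THEN S_sub] m(4-6) ab(2) ef(2) ab(1)[THEN S_sub] ef(1)[THEN S_sub]
    have i: "(e \<otimes> a) \<otimes> s \<in> S" "(e \<otimes> a) \<otimes> s = (e \<otimes> b) \<otimes> s'" "(e \<otimes> b) \<otimes> s' = f \<otimes> s''" 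
      using ef ab cl by (auto simp: m_assoc)
    obtain t where t: "t \<in> S" "t \<otimes> (e \<otimes> a \<otimes> r) = t \<otimes> (e \<otimes> b \<otimes> r')"
      using rel_any[OF 1, of "e \<otimes> a" "e \<otimes> b"] i cl by auto
    obtain t' where t': "t' \<in> S" "t' \<otimes> (e \<otimes> b \<otimes> r') = t' \<otimes> (f \<otimes> r'')"
      using rel_any[OF 2, of "e \<otimes> b" "f"] i cl by auto
    obtain x y where x: "x \<in> S" "y \<in> carrier R" "x \<otimes> t = y \<otimes> t'"
      using ore[of t t'] t t' S_sub by blast
    note ct = t(1)[THEN S_sub] t'(1)[THEN S_sub] x(1)[THEN S_sub] x(2)
    have "x \<otimes> t \<otimes> (e \<otimes> a \<otimes> r) = x \<otimes> (t \<otimes> (e \<otimes> b \<otimes> r'))" using t ct cl by (simp add: m_assoc)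
    also have "\<dots> = y \<otimes> (t' \<otimes> (e \<otimes> b \<otimes> r'))" using x(3) ct cl m_assoc by (metis m_closed)
    also have "\<dots> = x \<otimes> t \<otimes> (f \<otimes> r'')" unfolding x(3) t'(2) using ct cl by (simp add: m_assoc)
    finally show "(s,r) \<sim> (s'',r'')"
      using rel_by[of s s'' r r'' "e \<otimes> a" f "x \<otimes> t"] m i cl S_mult[OF x(1) t(1)] by auto
  qed
qed

lemma F_eq: "s \<in> S \<Longrightarrow> r \<in> carrier R \<Longrightarrow> s' \<in> S \<Longrightarrow> r' \<in> carrier R \<Longrightarrow> F s r = F s' r' \<longleftrightarrow> (s,r) \<sim> (s',r')"
  unfolding lfrac_def using eq_equiv_class_iff[OF equiv_rel] by auto

lemma F_mem: "p \<in> F s r \<longleftrightarrow> (s,r) \<sim> p" unfolding lfrac_def by auto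

lemma F_carrier: "s \<in> S \<Longrightarrow> r \<in> carrier R \<Longrightarrow> F s r \<in> carrier Q"
  unfolding left_localization_def lfrac_def by (auto simp: quotientI)

lemma carrier_F: assumes "X \<in> carrier Q" obtains s r where "s \<in> S" "r \<in> carrier R" "X = F s r"
  using assms unfolding left_localization_def lfrac_def by (auto elim!: quotientE)

lemma F_expand: "s \<in> S \<Longrightarrow> r \<in> carrier R \<Longrightarrow> a \<in> carrier R \<Longrightarrow> a \<otimes> s \<in> S \<Longrightarrow> F (a \<otimes> s) (a \<otimes> r) = F s r"
  using expand F_eq S_sub by (metis m_closed)

lemma rel_refl: "s \<in> S \<Longrightarrow> r \<in> carrier R \<Longrightarrow> (s,r) \<sim> (s,r)"
  using expand[of s r \<one>] S_sub by auto

lemma F_same: "s \<in> S \<Longrightarrow> r \<in> carrier R \<Longrightarrow> r' \<in> carrier R \<Longrightarrow> F s r = F s r' \<longleftrightarrow> (\<exists>t\<in>S. t \<otimes> r = t \<otimes> r')"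
  apply (subst F_eq, auto)
  using rel_any[of s r s r' \<one> \<one>] S_sub apply auto[1]
  using rel_by[of s s r r' \<one> \<one>] S_sub by auto

lemma mult_wd:
  assumes 1: "(s,r) \<sim> (s',r')" and 2: "(t,q) \<sim> (t',q')"
    and u: "u \<in> S" "b \<in> carrier R" "u \<otimes> r = b \<otimes> t"
    and u': "u' \<in> S" "b' \<in> carrier R" "u' \<otimes> r' = b' \<otimes> t'"
  shows "(u \<otimes> s, b \<otimes> q) \<sim> (u' \<otimes> s', b' \<otimes> q')"
proof -
  obtain c c' where c: "t \<in> S" "t' \<in> S" "q \<in> carrier R" "q' \<in> carrier R" "c \<in> carrier R" "c' \<in> carrier R"
   "c \<otimes> t \<in> S" "c \<otimes> t = c' \<otimes> t'" "c \<otimes> q = c' \<otimes> q'" using relD[OF 2] by metis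
  have m: "s \<in> S" "s' \<in> S" "r \<in> carrier R" "r' \<in> carrier R"
      using 1 unfolding lfrac_rel_def by auto
  have us: "u \<otimes> s \<in> S" "u' \<otimes> s' \<in> S" using u u' m S_mult by auto
  then obtain a a' where a: "a \<in> S" "a' \<in> carrier R" "a \<otimes> (u \<otimes> s) \<in> S" "a \<otimes> (u \<otimes> s) = a' \<otimes> (u' \<otimes> s')"
    using common by metis
  note cl = m(1,2)[THEN S_sub] m(3,4) c(1,2)[THEN S_sub] c(3-6) u(1)[THEN S_sub] u'(1)[THEN S_sub] u(2) u'(2) a(1)[THEN S_sub] a(2)
  obtain t0 where t0: "t0 \<in> S" "t0 \<otimes> (a \<otimes> u \<otimes> r) = t0 \<otimes> (a' \<otimes> u' \<otimes> r')"
    using rel_any[OF 1, of "a \<otimes> u" "a' \<otimes> u'"] a cl by (auto simp: m_assoc)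
  note ct = t0(1)[THEN S_sub]
  have e: "t0 \<otimes> a \<otimes> b \<otimes> t = t0 \<otimes> a' \<otimes> b' \<otimes> t'"
    using t0(2) cl ct u(3) u'(3) by (simp add: m_assoc)
  obtain w n where w: "w \<in> S" "n \<in> carrier R" "w \<otimes> (t0 \<otimes> a \<otimes> b \<otimes> t) = n \<otimes> (c \<otimes> t)"
    using ore[of "t0 \<otimes> a \<otimes> b \<otimes> t" "c \<otimes> t"] c(7) cl ct by auto
  note cw = w(1)[THEN S_sub] w(2)
  have "(w \<otimes> t0 \<otimes> a \<otimes> b) \<otimes> t = (n \<otimes> c) \<otimes> t" using w(3) cl ct cw by (simp add: m_assoc)
  then obtain x where x: "x \<in> S" "x \<otimes> (w \<otimes> t0 \<otimes> a \<otimes> b) = x \<otimes> (n \<otimes> c)"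
    using canc[of "w \<otimes> t0 \<otimes> a \<otimes> b" "n \<otimes> c" t] c(1) cl ct cw by auto
  have "w \<otimes> (t0 \<otimes> a' \<otimes> b' \<otimes> t') = n \<otimes> (c' \<otimes> t')" using w(3) e c(8) by simp
  then have "(w \<otimes> t0 \<otimes> a' \<otimes> b') \<otimes> t' = (n \<otimes> c') \<otimes> t'" using cl ct cw by (simp add: m_assoc)
  then obtain x' where x': "x' \<in> S" "x' \<otimes> (w \<otimes> t0 \<otimes> a' \<otimes> b') = x' \<otimes> (n \<otimes> c')"
    using canc[of "w \<otimes> t0 \<otimes> a' \<otimes> b'" "n \<otimes> c'" t'] c(2) cl ct cw by auto
  obtain p p' where p: "p \<in> S" "p' \<in> carrier R" "p \<otimes> x = p' \<otimes> x'" using ore[of x x'] x x' S_sub by blast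
  note cx = x(1)[THEN S_sub] x'(1)[THEN S_sub] p(1)[THEN S_sub] p(2)
  define z where "z = p \<otimes> x"
  have z: "z \<in> S" unfolding z_def using S_mult[OF p(1) x(1)] .
  note cz = z[THEN S_sub]
  have z1: "z \<otimes> (w \<otimes> t0 \<otimes> a \<otimes> b) = z \<otimes> (n \<otimes> c)" unfolding z_def using x(2) cx cl cw ct by (simp add: m_assoc)
  have z2: "z \<otimes> (w \<otimes> t0 \<otimes> a' \<otimes> b') = z \<otimes> (n \<otimes> c')" unfolding z_def p(3) using x'(2) cx cl cw ct by (simp add: m_assoc)
  have "(z \<otimes> w \<otimes> t0) \<otimes> (a \<otimes> (b \<otimes> q)) = z \<otimes> (w \<otimes> t0 \<otimes> a \<otimes> b) \<otimes> q" using cz cl cw ct by (simp add: m_assoc)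
  also have "\<dots> = z \<otimes> n \<otimes> (c \<otimes> q)" unfolding z1 using cz cl cw ct by (simp add: m_assoc)
  also have "\<dots> = z \<otimes> (n \<otimes> c') \<otimes> q'" unfolding c(9) using cz cl cw ct by (simp add: m_assoc)
  also have "\<dots> = (z \<otimes> w \<otimes> t0) \<otimes> (a' \<otimes> (b' \<otimes> q'))" unfolding z2[symmetric] using cz cl cw ct by (simp add: m_assoc)
  finally show ?thesis
    using rel_by[of "u \<otimes> s" "u' \<otimes> s'" "b \<otimes> q" "b' \<otimes> q'" a a' "z \<otimes> w \<otimes> t0"] us a cl S_mult z w t0 by auto
qed

lemma add_wd:
  assumes 1: "(s,r) \<sim> (s',r')" and 2: "(t,q) \<sim> (t',q')"
    and a: "a \<in> carrier R" "b \<in> carrier R" "a \<otimes> s \<in> S" "a \<otimes> s = b \<otimes> t"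
    and a': "a' \<in> carrier R" "b' \<in> carrier R" "a' \<otimes> s' \<in> S" "a' \<otimes> s' = b' \<otimes> t'"
  shows "(a \<otimes> s, a \<otimes> r \<oplus> b \<otimes> q) \<sim> (a' \<otimes> s', a' \<otimes> r' \<oplus> b' \<otimes> q')"
proof -
  have m: "s \<in> S" "s' \<in> S" "r \<in> carrier R" "r' \<in> carrier R" "t \<in> S" "t' \<in> S" "q \<in> carrier R" "q' \<in> carrier R"
      using 1 2 unfolding lfrac_rel_def by auto
  obtain e e' where e: "e \<in> S" "e' \<in> carrier R" "e \<otimes> (a \<otimes> s) \<in> S" "e \<otimes> (a \<otimes> s) = e' \<otimes> (a' \<otimes> s')"
    using common[OF a(3) a'(3)] by metis
  note cl = m(1,2,5,6)[THEN S_sub] m(3,4,7,8) a(1,2) a'(1,2) e(1)[THEN S_sub] e(2)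
  obtain t0 where t0: "t0 \<in> S" "t0 \<otimes> (e \<otimes> a \<otimes> r) = t0 \<otimes> (e' \<otimes> a' \<otimes> r')"
    using rel_any[OF 1, of "e \<otimes> a" "e' \<otimes> a'"] e cl by (auto simp: m_assoc)
  have "e \<otimes> b \<otimes> t = e' \<otimes> b' \<otimes> t'" "e \<otimes> b \<otimes> t \<in> S" using a(4) a'(4) e(3,4) cl by (auto simp: m_assoc)
  then obtain t1 where t1: "t1 \<in> S" "t1 \<otimes> (e \<otimes> b \<otimes> q) = t1 \<otimes> (e' \<otimes> b' \<otimes> q')"
    using rel_any[OF 2, of "e \<otimes> b" "e' \<otimes> b'"] cl by auto
  obtain p p' where p: "p \<in> S" "p' \<in> carrier R" "p \<otimes> t0 = p' \<otimes> t1" using ore[of t0 t1] t0 t1 S_sub by blast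
  note cx = t0(1)[THEN S_sub] t1(1)[THEN S_sub] p(1)[THEN S_sub] p(2)
  define z where "z = p \<otimes> t0"
  have z: "z \<in> S" unfolding z_def using S_mult[OF p(1) t0(1)] .
  note cz = z[THEN S_sub]
  have z1: "z \<otimes> (e \<otimes> a \<otimes> r) = z \<otimes> (e' \<otimes> a' \<otimes> r')" unfolding z_def using t0(2) cx cl by (simp add: m_assoc)
  have z2: "z \<otimes> (e \<otimes> b \<otimes> q) = z \<otimes> (e' \<otimes> b' \<otimes> q')" unfolding z_def p(3) using t1(2) cx cl by (simp add: m_assoc)
  have "z \<otimes> (e \<otimes> (a \<otimes> r \<oplus> b \<otimes> q)) = z \<otimes> (e \<otimes> a \<otimes> r) \<oplus> z \<otimes> (e \<otimes> b \<otimes> q)" using cz cl by (simp add: m_assoc r_distr)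
  also have "\<dots> = z \<otimes> (e' \<otimes> (a' \<otimes> r' \<oplus> b' \<otimes> q'))" unfolding z1 z2 using cz cl by (simp add: m_assoc r_distr)
  finally show ?thesis
    using rel_by[of "a \<otimes> s" "a' \<otimes> s'" "a \<otimes> r \<oplus> b \<otimes> q" "a' \<otimes> r' \<oplus> b' \<otimes> q'" e e' z] a a' e cl z by auto
qed

lemma mult_F:
  assumes m: "s \<in> S" "r \<in> carrier R" "t \<in> S" "q \<in> carrier R"
    and u: "u \<in> S" "b \<in> carrier R" "u \<otimes> r = b \<otimes> t"
  shows "F s r \<otimes>\<^bsub>Q\<^esub> F t q = F (u \<otimes> s) (b \<otimes> q)" (is "?L = ?R")
proof -
  have L: "?L = (\<Union>(s', r') \<in> F s r. \<Union>(t', q') \<in> F t q.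
        \<Union>{F (u \<otimes> s') (b \<otimes> q') | u b. u \<in> S \<and> b \<in> carrier R \<and> u \<otimes> r' = b \<otimes> t'})"
    unfolding left_localization_def by simp
  have "F (u' \<otimes> s') (b' \<otimes> q') = ?R" if "(s', r') \<in> F s r" "(t', q') \<in> F t q" "u' \<in> S" "b' \<in> carrier R" "u' \<otimes> r' = b' \<otimes> t'" for s' r' t' q' u' b'
  proof -
    have m': "s' \<in> S" "r' \<in> carrier R" "t' \<in> S" "q' \<in> carrier R" using that(1,2) unfolding F_mem lfrac_rel_def by auto
    show ?thesis using mult_wd[OF that(1,2)[unfolded F_mem] u that(3-5)] m m' u that(3-5) 
      by (subst eq_commute, subst F_eq) (auto simp: S_mult)
  qed
  moreover have "(s,r) \<in> F s r" "(t,q) \<in> F t q" using m rel_refl F_mem by auto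
  ultimately show ?thesis unfolding L
    by (intro Union_const[where P = "\<lambda>s' r' t' q' u b. u \<in> S \<and> b \<in> carrier R \<and> u \<otimes> r' = b \<otimes> t'"
      and f = "\<lambda>s' r' t' q' u b. F (u \<otimes> s') (b \<otimes> q')" and ?u0.0 = u and ?b0.0 = b])
     ((elim conjE; assumption | blast), assumption+, intro conjI u)
qed

lemma add_F:
  assumes m: "s \<in> S" "r \<in> carrier R" "t \<in> S" "q \<in> carrier R"
    and a: "a \<in> carrier R" "b \<in> carrier R" "a \<otimes> s \<in> S" "a \<otimes> s = b \<otimes> t"
  shows "F s r \<oplus>\<^bsub>Q\<^esub> F t q = F (a \<otimes> s) (a \<otimes> r \<oplus> b \<otimes> q)" (is "?L = ?R")
proof -
  have L: "?L = (\<Union>(s', r') \<in> F s r. \<Union>(t', q') \<in> F t q.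
        \<Union>{F (a \<otimes> s') (a \<otimes> r' \<oplus> b \<otimes> q') | a b. a \<in> carrier R \<and> b \<in> carrier R \<and> a \<otimes> s' \<in> S \<and> a \<otimes> s' = b \<otimes> t'})"
    unfolding left_localization_def by simp
  have "F (u' \<otimes> s') (u' \<otimes> r' \<oplus> b' \<otimes> q') = ?R" if "(s', r') \<in> F s r" "(t', q') \<in> F t q" "u' \<in> carrier R" "b' \<in> carrier R" "u' \<otimes> s' \<in> S" "u' \<otimes> s' = b' \<otimes> t'" for s' r' t' q' u' b'
  proof -
    have m': "s' \<in> S" "r' \<in> carrier R" "t' \<in> S" "q' \<in> carrier R" using that(1,2) unfolding F_mem lfrac_rel_def by auto
    show ?thesis using add_wd[OF that(1,2)[unfolded F_mem] a that(3-6)] m m' a that(3-6) 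
      by (subst eq_commute, subst F_eq) (auto simp: S_mult)
  qed
  moreover have "(s,r) \<in> F s r" "(t,q) \<in> F t q" using m rel_refl F_mem by auto
  ultimately show ?thesis unfolding L
    by (intro Union_const[where P = "\<lambda>s' r' t' q' a b. a \<in> carrier R \<and> b \<in> carrier R \<and> a \<otimes> s' \<in> S \<and> a \<otimes> s' = b \<otimes> t'"
      and f = "\<lambda>s' r' t' q' a b. F (a \<otimes> s') (a \<otimes> r' \<oplus> b \<otimes> q')" and ?u0.0 = a and ?b0.0 = b])
     ((elim conjE; assumption | blast), assumption+, intro conjI a)
qed

lemma add_F_same:
  assumes "s \<in> S" "r \<in> carrier R" "q \<in> carrier R"
  shows "F s r \<oplus>\<^bsub>Q\<^esub> F s q = F s (r \<oplus> q)"
  using add_F[of s r s q \<one> \<one>] assms S_sub by auto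

lemma mult_F_simple:
  assumes "s \<in> S" "b \<in> carrier R" "t \<in> S" "q \<in> carrier R"
  shows "F s (b \<otimes> t) \<otimes>\<^bsub>Q\<^esub> F t q = F s (b \<otimes> q)"
  using mult_F[of s "b \<otimes> t" t q \<one> b] assms S_sub S_one by auto

lemma two_carrier:
  assumes "X \<in> carrier Q" "Y \<in> carrier Q"
  obtains s x y where "s \<in> S" "x \<in> carrier R" "y \<in> carrier R" "X = F s x" "Y = F s y"
proof -
  obtain s x t y where 1: "s \<in> S" "x \<in> carrier R" "X = F s x" "t \<in> S" "y \<in> carrier R" "Y = F t y"
    using carrier_F[OF assms(1)] carrier_F[OF assms(2)] by metis
  obtain a b where ab: "a \<in> S" "b \<in> carrier R" "a \<otimes> s \<in> S" "a \<otimes> s = b \<otimes> t" using common 1 by metis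
  have "X = F (a \<otimes> s) (a \<otimes> x)" using F_expand 1 ab S_sub by metis
  moreover have "Y = F (a \<otimes> s) (b \<otimes> y)" unfolding ab(4) using F_expand 1 ab S_sub by metis
  ultimately show ?thesis using that[of "a \<otimes> s" "a \<otimes> x" "b \<otimes> y"] 1 ab S_sub by auto
qed

lemma aligned:
  assumes "X \<in> carrier Q" "t \<in> S"
  obtains s b where "s \<in> S" "b \<in> carrier R" "X = F s (b \<otimes> t)"
proof -
  obtain s x where 1: "s \<in> S" "x \<in> carrier R" "X = F s x" using carrier_F[OF assms(1)] by metis
  obtain u b where u: "u \<in> S" "b \<in> carrier R" "u \<otimes> x = b \<otimes> t" using ore[of x t] 1 assms by blast
  have "X = F (u \<otimes> s) (b \<otimes> t)" using F_expand[of s x u] 1 u S_sub S_mult by auto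
  then show ?thesis using that 1 u S_mult by blast
qed

lemma aligned2:
  assumes "X \<in> carrier Q" "Y \<in> carrier Q" "t \<in> S"
  obtains s b c where "s \<in> S" "b \<in> carrier R" "c \<in> carrier R" "X = F s (b \<otimes> t)" "Y = F s (c \<otimes> t)"
proof -
  obtain s x y where 1: "s \<in> S" "x \<in> carrier R" "y \<in> carrier R" "X = F s x" "Y = F s y" using two_carrier[OF assms(1,2)] by metis
  obtain u b where u: "u \<in> S" "b \<in> carrier R" "u \<otimes> x = b \<otimes> t" using ore[of x t] 1 assms by blast
  obtain v c where v: "v \<in> S" "c \<in> carrier R" "v \<otimes> (u \<otimes> y) = c \<otimes> t" using ore[of "u \<otimes> y" t] 1 assms u S_sub by blast
  note cl = 1(1)[THEN S_sub] 1(2,3) u(1)[THEN S_sub] u(2) v(1)[THEN S_sub] v(2) assms(3)[THEN S_sub]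
  have S: "v \<otimes> u \<otimes> s \<in> S" using u v 1 S_mult by auto
  have "X = F (v \<otimes> u \<otimes> s) (v \<otimes> u \<otimes> x)" "Y = F (v \<otimes> u \<otimes> s) (v \<otimes> u \<otimes> y)" using F_expand[of s _ "v \<otimes> u"] 1 cl S by auto
  moreover have "v \<otimes> u \<otimes> x = v \<otimes> b \<otimes> t" "v \<otimes> u \<otimes> y = c \<otimes> t" using u(3) v(3) cl by (auto simp: m_assoc)
  ultimately show ?thesis using that[of "v \<otimes> u \<otimes> s" "v \<otimes> b" c] S cl by auto
qed

lemma Q_one: "\<one>\<^bsub>Q\<^esub> = F \<one> \<one>" and Q_zero: "\<zero>\<^bsub>Q\<^esub> = F \<one> \<zero>"
  unfolding left_localization_def by auto

lemma F_self: "s \<in> S \<Longrightarrow> F s s = \<one>\<^bsub>Q\<^esub>" unfolding Q_one using F_expand[of \<one> \<one> s] S_sub S_one by auto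
lemma F_zero: "s \<in> S \<Longrightarrow> F s \<zero> = \<zero>\<^bsub>Q\<^esub>" unfolding Q_zero using F_expand[of \<one> \<zero> s] S_sub S_one by auto

theorem Q_ring: "ring Q"
proof (rule ringI)
  show "abelian_group Q"
  proof (rule abelian_groupI)
    fix X Y assume XY: "X \<in> carrier Q" "Y \<in> carrier Q"
    then obtain s x y where 1: "s \<in> S" "x \<in> carrier R" "y \<in> carrier R" "X = F s x" "Y = F s y" using two_carrier by metis
    show "X \<oplus>\<^bsub>Q\<^esub> Y \<in> carrier Q" using 1 add_F_same F_carrier by auto
    show "X \<oplus>\<^bsub>Q\<^esub> Y = Y \<oplus>\<^bsub>Q\<^esub> X" using 1 add_F_same a_comm by auto
    fix Z assume Z: "Z \<in> carrier Q"
    obtain t z where 2: "t \<in> S" "z \<in> carrier R" "Z = F t z" using carrier_F[OF Z] by metis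
    obtain a b where ab: "a \<in> S" "b \<in> carrier R" "a \<otimes> s \<in> S" "a \<otimes> s = b \<otimes> t" using common 1 2 by metis
    have "X = F (a \<otimes> s) (a \<otimes> x)" "Y = F (a \<otimes> s) (a \<otimes> y)" using F_expand[OF 1(1) _ S_sub[OF ab(1)] ab(3)] 1 by auto
    moreover have "Z = F (a \<otimes> s) (b \<otimes> z)" unfolding ab(4) using F_expand 2 ab S_sub by metis
    ultimately show "X \<oplus>\<^bsub>Q\<^esub> Y \<oplus>\<^bsub>Q\<^esub> Z = X \<oplus>\<^bsub>Q\<^esub> (Y \<oplus>\<^bsub>Q\<^esub> Z)" 
      using add_F_same[of "a \<otimes> s"] 1 2 ab S_sub by (simp add: a_assoc)
  next
    show "\<zero>\<^bsub>Q\<^esub> \<in> carrier Q" unfolding Q_zero using F_carrier S_one by auto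
    fix X assume "X \<in> carrier Q"
    then obtain s x where 1: "s \<in> S" "x \<in> carrier R" "X = F s x" using carrier_F by metis
    show "\<zero>\<^bsub>Q\<^esub> \<oplus>\<^bsub>Q\<^esub> X = X" using 1 F_zero[of s] add_F_same[of s \<zero> x] by auto
    show "\<exists>y\<in>carrier Q. y \<oplus>\<^bsub>Q\<^esub> X = \<zero>\<^bsub>Q\<^esub>"
      using 1 F_zero[of s] add_F_same[of s "\<ominus> x" x] F_carrier[of s "\<ominus> x"] l_neg by (intro bexI[of _ "F s (\<ominus> x)"]) auto
  qed
next
  have mc: "X \<otimes>\<^bsub>Q\<^esub> Y \<in> carrier Q" if X: "X \<in> carrier Q" and Y: "Y \<in> carrier Q" for X Y
  proof -
    obtain t y where 1: "t \<in> S" "y \<in> carrier R" "Y = F t y" using carrier_F[OF Y] by metis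
    obtain s b where 2: "s \<in> S" "b \<in> carrier R" "X = F s (b \<otimes> t)" using aligned[OF X 1(1)] by metis
    show ?thesis using 1 2 mult_F_simple F_carrier by auto
  qed
  show "monoid Q"
  proof (rule monoidI)
    fix X Y Z assume X: "X \<in> carrier Q" and Y: "Y \<in> carrier Q" and Z: "Z \<in> carrier Q"
    show "X \<otimes>\<^bsub>Q\<^esub> Y \<in> carrier Q" by (rule mc[OF X Y])
    obtain w z where 3: "w \<in> S" "z \<in> carrier R" "Z = F w z" using carrier_F[OF Z] by metis
    obtain t c where 2: "t \<in> S" "c \<in> carrier R" "Y = F t (c \<otimes> w)" using aligned[OF Y 3(1)] by metis
    obtain s b where 1: "s \<in> S" "b \<in> carrier R" "X = F s (b \<otimes> t)" using aligned[OF X 2(1)] by metis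
    have "X \<otimes>\<^bsub>Q\<^esub> Y = F s ((b \<otimes> c) \<otimes> w)" using 1 2 3 mult_F_simple S_sub by (simp add: m_assoc)
    then have "X \<otimes>\<^bsub>Q\<^esub> Y \<otimes>\<^bsub>Q\<^esub> Z = F s (b \<otimes> c \<otimes> z)" using 1 2 3 mult_F_simple[of s "b \<otimes> c" w z] by simp
    also have "\<dots> = X \<otimes>\<^bsub>Q\<^esub> (Y \<otimes>\<^bsub>Q\<^esub> Z)" using 1 2 3 mult_F_simple S_sub by (simp add: m_assoc)
    finally show "X \<otimes>\<^bsub>Q\<^esub> Y \<otimes>\<^bsub>Q\<^esub> Z = X \<otimes>\<^bsub>Q\<^esub> (Y \<otimes>\<^bsub>Q\<^esub> Z)" .
  next
    show "\<one>\<^bsub>Q\<^esub> \<in> carrier Q" unfolding Q_one using F_carrier S_one by auto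
    fix X assume "X \<in> carrier Q"
    then obtain s x where 1: "s \<in> S" "x \<in> carrier R" "X = F s x" using carrier_F by metis
    show "\<one>\<^bsub>Q\<^esub> \<otimes>\<^bsub>Q\<^esub> X = X" using 1 F_self[of s] mult_F_simple[of s \<one> s x] S_sub by auto
    show "X \<otimes>\<^bsub>Q\<^esub> \<one>\<^bsub>Q\<^esub> = X" unfolding Q_one using 1 mult_F_simple[of s x \<one> \<one>] S_sub S_one by auto
  qed
  fix X Y Z assume X: "X \<in> carrier Q" and Y: "Y \<in> carrier Q" and Z: "Z \<in> carrier Q"
  show "(X \<oplus>\<^bsub>Q\<^esub> Y) \<otimes>\<^bsub>Q\<^esub> Z = X \<otimes>\<^bsub>Q\<^esub> Z \<oplus>\<^bsub>Q\<^esub> Y \<otimes>\<^bsub>Q\<^esub> Z"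
  proof -
    obtain t z where 1: "t \<in> S" "z \<in> carrier R" "Z = F t z" using carrier_F[OF Z] by metis
    obtain s b c where 2: "s \<in> S" "b \<in> carrier R" "c \<in> carrier R" "X = F s (b \<otimes> t)" "Y = F s (c \<otimes> t)" 
      using aligned2[OF X Y 1(1)] by metis
    have "X \<oplus>\<^bsub>Q\<^esub> Y = F s ((b \<oplus> c) \<otimes> t)" using 1 2 add_F_same S_sub by (simp add: l_distr)
    then show ?thesis using 1 2 mult_F_simple add_F_same by (simp add: l_distr)
  qed
  show "Z \<otimes>\<^bsub>Q\<^esub> (X \<oplus>\<^bsub>Q\<^esub> Y) = Z \<otimes>\<^bsub>Q\<^esub> X \<oplus>\<^bsub>Q\<^esub> Z \<otimes>\<^bsub>Q\<^esub> Y"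
  proof -
    obtain s x y where 1: "s \<in> S" "x \<in> carrier R" "y \<in> carrier R" "X = F s x" "Y = F s y" using two_carrier[OF X Y] by metis
    obtain t b where 2: "t \<in> S" "b \<in> carrier R" "Z = F t (b \<otimes> s)" using aligned[OF Z 1(1)] by metis
    show ?thesis using 1 2 mult_F_simple add_F_same by (simp add: r_distr)
  qed
qed

theorem map_hom: "left_localization_map R S \<in> ring_hom R Q"
proof (rule ring_hom_memI)
  fix x y assume "x \<in> carrier R" "y \<in> carrier R"
  then show "left_localization_map R S (x \<otimes> y) = left_localization_map R S x \<otimes>\<^bsub>Q\<^esub> left_localization_map R S y"
   "left_localization_map R S (x \<oplus> y) = left_localization_map R S x \<oplus>\<^bsub>Q\<^esub> left_localization_map R S y"
   "left_localization_map R S x \<in> carrier Q"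
    unfolding left_localization_map_def using mult_F_simple[of \<one> x \<one> y] add_F_same[of \<one> x y] S_one F_carrier by auto
qed (simp add: Q_one left_localization_map_def)

theorem map_kernel: 
  assumes "r \<in> carrier R" shows "left_localization_map R S r = \<zero>\<^bsub>Q\<^esub> \<longleftrightarrow> r \<in> ass_l R S"
  unfolding left_localization_map_def Q_zero ass_l_def using assms F_same[of \<one> r \<zero>] S_one S_sub by auto

theorem map_Units: assumes "s \<in> S"
  shows "left_localization_map R S s \<in> Units Q" "inv\<^bsub>Q\<^esub> (left_localization_map R S s) = F s \<one>"
proof -
  interpret Q: ring Q by (rule Q_ring)
  have 1: "F s \<one> \<otimes>\<^bsub>Q\<^esub> F \<one> s = \<one>\<^bsub>Q\<^esub>" using mult_F_simple[of s \<one> \<one> s] assms S_one S_sub F_self by auto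
  have 2: "F \<one> s \<otimes>\<^bsub>Q\<^esub> F s \<one> = \<one>\<^bsub>Q\<^esub>" using mult_F_simple[of \<one> \<one> s \<one>] assms S_one S_sub F_self by auto
  have c: "F s \<one> \<in> carrier Q" "F \<one> s \<in> carrier Q" using assms S_one S_sub F_carrier by auto
  show "left_localization_map R S s \<in> Units Q" unfolding left_localization_map_def Units_def using 1 2 c by auto
  show "inv\<^bsub>Q\<^esub> (left_localization_map R S s) = F s \<one>" unfolding left_localization_map_def
    using 1 2 c Q.inv_char by metis
qed

theorem lfrac_eq: assumes "s \<in> S" "r \<in> carrier R"
  shows "F s r = left_fraction Q (left_localization_map R S) s r"
  unfolding left_fraction_def map_Units(2)[OF assms(1)] unfolding left_localization_map_def
  using mult_F_simple[of s \<one> \<one> r] assms S_one by auto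

end

lemma opp_ring: "ring R \<Longrightarrow> ring (opposite_ring R)"
proof -
  assume "ring R"
  then interpret ring R .
  show ?thesis unfolding opposite_ring_def
    by (rule ringI, rule abelian_groupI, auto intro!: monoidI simp: m_assoc l_distr r_distr a_assoc a_comm l_neg)
       (use a_assoc a_comm a_lcomm l_neg in auto)
qed

lemma opp_den: "right_denominator_set R S \<Longrightarrow> left_denominator_set (opposite_ring R) S"
  unfolding left_denominator_set_def right_denominator_set_def left_ore_set_def right_ore_set_def
   multiplicative_subset_def opposite_ring_def ass_l_def ass_r_def r_coset_def l_coset_def by auto

end

theory Submission
  imports Defs
begin

text \<open>
  Left division with remainder passes to \<open>R/\<aa>\<close> by choosing in the coset of the divisor a
  representative with least value. In a ring of left fractions, \<open>a = q b + r\<close> gives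
  \<open>s\<^sup>-\<^sup>1 a = (s\<^sup>-\<^sup>1 q t) (t\<^sup>-\<^sup>1 b) + s\<^sup>-\<^sup>1 r\<close>, so the point is that \<open>\<delta>\<close> is well defined.
  If \<open>s\<^sup>-\<^sup>1 r = t\<^sup>-\<^sup>1 q\<close> and \<open>a s = b t\<close> with \<open>a\<close> a denominator, then \<open>a r = b q\<close>; right
  saturation says that \<open>b\<close> is a denominator too. In the two-sided case one writes both
  fractions as one right fraction \<open>r' s'\<^sup>-\<^sup>1\<close> and uses \<open>r s' = s r'\<close>, \<open>q s' = t r'\<close>.
  The right-handed versions are the left-handed ones for the opposite rings.
\<close>

section \<open>Rings of left fractions described by their properties\<close>

text \<open>The ring \<open>Q\<close> is kept abstract because the same facts are needed for several
  models: \<open>S^-1 R\<close> viewed over the quotient ring, the left localization of the quotient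
  ring itself, and its right localization after passing to opposite rings. Injectivity of
  \<open>j\<close> reflects that the torsion \<open>ass_l R S\<close> has already been factored
  out.\<close>

locale left_fractions = hom: ring_hom_ring A Q j
  for A (structure) and Q (structure) and j +
  fixes T
  assumes ore_set: "left_ore_set A T"
    and units: "t \<in> T \<Longrightarrow> j t \<in> Units Q"
    and fractions: "x \<in> carrier Q \<Longrightarrow> \<exists>t\<in>T. \<exists>r\<in>carrier A. x = left_fraction Q j t r"
    and inj: "inj_on j (carrier A)"
begin

lemma T_closed: "t \<in> T \<Longrightarrow> t \<in> carrier A"
  and T_one: "\<one> \<in> T"
  and T_mult: "s \<in> T \<Longrightarrow> t \<in> T \<Longrightarrow> s \<otimes> t \<in> T"
  using ore_set unfolding left_ore_set_def multiplicative_subset_def by auto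

lemma inj_iff: "x \<in> carrier A \<Longrightarrow> y \<in> carrier A \<Longrightarrow> j x = j y \<longleftrightarrow> x = y"
  using inj by (auto dest: inj_onD)

lemma left_ore:
  assumes "r \<in> carrier A" "s \<in> T"
  obtains u b where "u \<in> T" "b \<in> carrier A" "u \<otimes> r = b \<otimes> s"
proof -
  have "(T #> r) \<inter> (carrier A #> s) \<noteq> {}"
    using ore_set assms unfolding left_ore_set_def by auto
  then show ?thesis using that unfolding r_coset_def by auto
qed

lemma common_denominator:
  assumes "s \<in> T" "t \<in> T"
  obtains a b where "a \<in> carrier A" "b \<in> carrier A" "a \<otimes> s \<in> T" "a \<otimes> s = b \<otimes> t"
proof -
  obtain u b where "u \<in> T" "b \<in> carrier A" "u \<otimes> s = b \<otimes> t"
    using left_ore[OF T_closed[OF assms(1)] assms(2)] .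
  then show ?thesis using that[of u b] T_closed T_mult[OF _ assms(1)] by blast
qed

lemma fraction_closed: "t \<in> T \<Longrightarrow> r \<in> carrier A \<Longrightarrow> left_fraction Q j t r \<in> carrier Q"
  unfolding left_fraction_def using units by auto

text \<open>Multiplication by the unit \<open>j t\<close> is reversible, so an equation with a
  fraction becomes one free of inverses. Products of fractions and their equality are later computed
  by clearing denominators in this way.\<close>

lemma eq_fraction_iff:
  assumes "t \<in> T" "r \<in> carrier A" "x \<in> carrier Q"
  shows "x = left_fraction Q j t r \<longleftrightarrow> j t \<otimes>\<^bsub>Q\<^esub> x = j r"
proof -
  have u: "j t \<in> Units Q" "inv\<^bsub>Q\<^esub> j t \<in> carrier Q" "j t \<in> carrier Q" "j r \<in> carrier Q"
    using units assms T_closed by auto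
  show ?thesis
  proof
    assume "x = left_fraction Q j t r"
    then show "j t \<otimes>\<^bsub>Q\<^esub> x = j r"
      unfolding left_fraction_def using u by (simp add: hom.S.m_assoc[symmetric])
  next
    assume "j t \<otimes>\<^bsub>Q\<^esub> x = j r"
    then show "x = left_fraction Q j t r"
      unfolding left_fraction_def using u assms by (metis hom.S.Units_l_inv hom.S.l_one hom.S.m_assoc)
  qed
qed

lemma mult_fraction: "t \<in> T \<Longrightarrow> r \<in> carrier A \<Longrightarrow> j t \<otimes>\<^bsub>Q\<^esub> left_fraction Q j t r = j r"
  using eq_fraction_iff[of t r "left_fraction Q j t r"] fraction_closed by simp

text \<open>Both sides are multiplied by the same unit
  \<open>j (a \<otimes> s) = j (b \<otimes> t)\<close>, which leaves the images of
  \<open>a \<otimes> r\<close> and \<open>b \<otimes> q\<close>. As \<open>j\<close> is injective,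
  these can be compared in \<open>A\<close> without multiplying by a further denominator.\<close>

lemma fraction_eq_iff:
  assumes "s \<in> T" "t \<in> T" "r \<in> carrier A" "q \<in> carrier A"
    and ab: "a \<in> carrier A" "b \<in> carrier A" "a \<otimes> s \<in> T" "a \<otimes> s = b \<otimes> t"
  shows "left_fraction Q j s r = left_fraction Q j t q \<longleftrightarrow> a \<otimes> r = b \<otimes> q"
proof -
  let ?x = "left_fraction Q j s r" and ?y = "left_fraction Q j t q"
  note cl = assms(1,2)[THEN T_closed] assms(3,4) ab(1,2)
    fraction_closed[OF assms(1,3)] fraction_closed[OF assms(2,4)]
  have 1: "j (a \<otimes> s) \<otimes>\<^bsub>Q\<^esub> ?x = j (a \<otimes> r)"
    using cl mult_fraction[OF assms(1,3)] by (simp add: hom.S.m_assoc)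
  have 2: "j (a \<otimes> s) \<otimes>\<^bsub>Q\<^esub> ?y = j (b \<otimes> q)"
    unfolding ab(4) using cl mult_fraction[OF assms(2,4)] by (simp add: hom.S.m_assoc)
  have "?x = ?y \<longleftrightarrow> j (a \<otimes> s) \<otimes>\<^bsub>Q\<^esub> ?x = j (a \<otimes> s) \<otimes>\<^bsub>Q\<^esub> ?y"
    using hom.S.Units_l_cancel[OF units[OF ab(3)] cl(7,8)] by simp
  also have "\<dots> \<longleftrightarrow> a \<otimes> r = b \<otimes> q"
    unfolding 1 2 using inj_iff[of "a \<otimes> r" "b \<otimes> q"] cl by simp
  finally show ?thesis .
qed

lemma fraction_zero_iff:
  "t \<in> T \<Longrightarrow> r \<in> carrier A \<Longrightarrow> left_fraction Q j t r = \<zero>\<^bsub>Q\<^esub> \<longleftrightarrow> r = \<zero>"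
  using eq_fraction_iff[of t r "\<zero>\<^bsub>Q\<^esub>"] inj_iff[of r \<zero>]
  by (metis T_closed hom.R.zero_closed hom.S.r_null hom.S.zero_closed hom.hom_closed hom.hom_zero)

lemma fraction_expand:
  assumes "s \<in> T" "r \<in> carrier A" "a \<in> carrier A" "a \<otimes> s \<in> T"
  shows "left_fraction Q j (a \<otimes> s) (a \<otimes> r) = left_fraction Q j s r"
  using fraction_eq_iff[of s "a \<otimes> s" r "a \<otimes> r" a \<one>] assms T_closed by auto

lemma common_fractions:
  assumes "x \<in> carrier Q" "y \<in> carrier Q"
  obtains s r q where "s \<in> T" "r \<in> carrier A" "q \<in> carrier A"
    "x = left_fraction Q j s r" "y = left_fraction Q j s q"
proof -
  obtain s r t q where 1: "s \<in> T" "r \<in> carrier A" "x = left_fraction Q j s r"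
    "t \<in> T" "q \<in> carrier A" "y = left_fraction Q j t q"
    using fractions[OF assms(1)] fractions[OF assms(2)] by metis
  obtain a b where ab: "a \<in> carrier A" "b \<in> carrier A" "a \<otimes> s \<in> T" "a \<otimes> s = b \<otimes> t"
    using common_denominator[OF 1(1,4)] by metis
  have "x = left_fraction Q j (a \<otimes> s) (a \<otimes> r)" "y = left_fraction Q j (a \<otimes> s) (b \<otimes> q)"
    using fraction_expand[of s r a] fraction_expand[of t q b] 1 ab by auto
  then show ?thesis using that[of "a \<otimes> s" "a \<otimes> r" "b \<otimes> q"] 1(2,5) ab(1-3) by blast
qed

lemma fraction_add:
  assumes "s \<in> T" "r \<in> carrier A" "q \<in> carrier A"
  shows "left_fraction Q j s r \<oplus>\<^bsub>Q\<^esub> left_fraction Q j s q = left_fraction Q j s (r \<oplus> q)"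
  unfolding left_fraction_def using assms units T_closed by (simp add: hom.S.r_distr)

text \<open>The relation \<open>u \<otimes> r = b \<otimes> t\<close> moves the inner denominator to
  the left: in \<open>Q\<close> it says \<open>r t^-1 = u^-1 b\<close>.\<close>

lemma fraction_mult:
  assumes "s \<in> T" "t \<in> T" "r \<in> carrier A" "q \<in> carrier A"
    and ub: "u \<in> T" "b \<in> carrier A" "u \<otimes> r = b \<otimes> t"
  shows "left_fraction Q j s r \<otimes>\<^bsub>Q\<^esub> left_fraction Q j t q = left_fraction Q j (u \<otimes> s) (b \<otimes> q)"
proof -
  let ?x = "left_fraction Q j s r" and ?y = "left_fraction Q j t q"
  note cl = assms(1,2,5)[THEN T_closed] assms(3,4) ub(2)
    fraction_closed[OF assms(1,3)] fraction_closed[OF assms(2,4)]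
  have "j (u \<otimes> s) \<otimes>\<^bsub>Q\<^esub> (?x \<otimes>\<^bsub>Q\<^esub> ?y) = j u \<otimes>\<^bsub>Q\<^esub> (j s \<otimes>\<^bsub>Q\<^esub> ?x) \<otimes>\<^bsub>Q\<^esub> ?y"
    using cl by (simp add: hom.S.m_assoc)
  also have "\<dots> = j (b \<otimes> t) \<otimes>\<^bsub>Q\<^esub> ?y"
    unfolding mult_fraction[OF assms(1,3)] ub(3)[symmetric] using cl by simp
  also have "\<dots> = j (b \<otimes> q)"
    using mult_fraction[OF assms(2,4)] cl by (simp add: hom.S.m_assoc)
  finally show ?thesis
    using eq_fraction_iff[of "u \<otimes> s" "b \<otimes> q" "?x \<otimes>\<^bsub>Q\<^esub> ?y"] cl T_mult[OF ub(1) assms(1)] by simp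
qed

lemma fraction_one: "r \<in> carrier A \<Longrightarrow> left_fraction Q j \<one> r = j r"
  using eq_fraction_iff[of \<one> r "j r"] T_one by auto

lemma ex_fraction_function:
  assumes "\<And>s t r q. s \<in> T \<Longrightarrow> t \<in> T \<Longrightarrow> r \<in> carrier A - {\<zero>} \<Longrightarrow> q \<in> carrier A - {\<zero>} \<Longrightarrow>
    left_fraction Q j s r = left_fraction Q j t q \<Longrightarrow> d r = d q"
  shows "\<exists>\<delta>. \<forall>s\<in>T. \<forall>r \<in> carrier A - {\<zero>}. \<delta> (left_fraction Q j s r) = d r"
proof (intro exI ballI)
  fix s r assume sr: "s \<in> T" "r \<in> carrier A - {\<zero>}"
  \<comment> \<open>The function picks a value attached to some presentation of its argument with
    nonzero numerator. Zero and elements outside the carrier have no such presentation, and the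
    arbitrary value there does no harm.\<close>
  let ?P = "\<lambda>x p. \<exists>t\<in>T. \<exists>q \<in> carrier A - {\<zero>}. x = left_fraction Q j t q \<and> p = d q"
  have "?P (left_fraction Q j s r) (SOME p. ?P (left_fraction Q j s r) p)"
    by (rule someI[of "?P _" "d r"]) (use sr in blast)
  then obtain t q where "t \<in> T" "q \<in> carrier A - {\<zero>}"
    "left_fraction Q j s r = left_fraction Q j t q"
    "(SOME p. ?P (left_fraction Q j s r) p) = d q"
    by blast
  then show "(SOME p. ?P (left_fraction Q j s r) p) = d r"
    using assms[OF sr(1) _ sr(2)] by simp
qed

lemma left_euclidean_fractions:
  assumes euclid: "left_euclidean_ring A d"
    and \<delta>: "\<And>s r. s \<in> T \<Longrightarrow> r \<in> carrier A - {\<zero>} \<Longrightarrow> \<delta> (left_fraction Q j s r) = d r"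
  shows "left_euclidean_ring Q \<delta>"
  unfolding left_euclidean_ring_def
proof (intro conjI ballI)
  show "ring Q" by (rule hom.S.ring_axioms)
  \<comment> \<open>With this inclusion a descending chain of values of \<delta> is also one of
    values of \<open>d\<close>, hence it stabilizes.\<close>
  have "\<delta> ` (carrier Q - {\<zero>\<^bsub>Q\<^esub>}) \<subseteq> d ` (carrier A - {\<zero>})"
  proof
    fix p assume "p \<in> \<delta> ` (carrier Q - {\<zero>\<^bsub>Q\<^esub>})"
    then obtain x where x: "x \<in> carrier Q" "x \<noteq> \<zero>\<^bsub>Q\<^esub>" "p = \<delta> x" by auto
    then obtain t r where t: "t \<in> T" "r \<in> carrier A" "x = left_fraction Q j t r"
      using fractions by metis
    then have "r \<in> carrier A - {\<zero>}" using x fraction_zero_iff by auto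
    then show "p \<in> d ` (carrier A - {\<zero>})" using \<delta> t x by auto
  qed
  then show "artinian_poset (\<delta> ` (carrier Q - {\<zero>\<^bsub>Q\<^esub>}))"
    using euclid unfolding left_euclidean_ring_def artinian_poset_def by blast
  fix x y assume xy: "x \<in> carrier Q - {\<zero>\<^bsub>Q\<^esub>}" "y \<in> carrier Q - {\<zero>\<^bsub>Q\<^esub>}"
  then obtain s a t b where f: "s \<in> T" "a \<in> carrier A" "x = left_fraction Q j s a"
    "t \<in> T" "b \<in> carrier A" "y = left_fraction Q j t b"
    using fractions by (metis DiffD1)
  have ab: "a \<in> carrier A - {\<zero>}" "b \<in> carrier A - {\<zero>}"
    using f xy fraction_zero_iff by auto
  then obtain q r where q: "q \<in> carrier A" "r \<in> carrier A" "a = q \<otimes> b \<oplus> r" "r = \<zero> \<or> d r < d b"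
    using euclid unfolding left_euclidean_ring_def by meson
  \<comment> \<open>The factor \<open>t\<close> in the numerator of \<open>?q\<close> cancels the
    denominator of \<open>y\<close>, so the unrelated denominators \<open>s\<close> and
    \<open>t\<close> need not be made equal first.\<close>
  let ?q = "left_fraction Q j s (q \<otimes> t)" and ?r = "left_fraction Q j s r"
  have "?q \<otimes>\<^bsub>Q\<^esub> y = left_fraction Q j s (q \<otimes> b)"
    unfolding f(6) using fraction_mult[of s t "q \<otimes> t" b \<one> q] f q T_one T_closed by auto
  then have "x = ?q \<otimes>\<^bsub>Q\<^esub> y \<oplus>\<^bsub>Q\<^esub> ?r" using fraction_add f q by simp
  moreover have "?r = \<zero>\<^bsub>Q\<^esub> \<or> \<delta> ?r < \<delta> y"
    using q(2,4) f ab \<delta> fraction_zero_iff by (cases "r = \<zero>") auto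
  ultimately show "\<exists>q\<in>carrier Q. \<exists>r\<in>carrier Q. x = q \<otimes>\<^bsub>Q\<^esub> y \<oplus>\<^bsub>Q\<^esub> r \<and> (r = \<zero>\<^bsub>Q\<^esub> \<or> \<delta> r < \<delta> y)"
    using fraction_closed f q T_closed by blast
qed

lemma saturated_consistent:
  assumes sat: "right_saturated A T Q j"
    and inv: "\<And>s r. s \<in> T \<Longrightarrow> r \<in> carrier A - {\<zero>} \<Longrightarrow> d (s \<otimes> r) = d r"
    and st: "s \<in> T" "t \<in> T" "r \<in> carrier A - {\<zero>}" "q \<in> carrier A - {\<zero>}"
    and eq: "left_fraction Q j s r = left_fraction Q j t q"
  shows "d r = d q"
proof -
  obtain a b where ab: "a \<in> T" "b \<in> carrier A" "a \<otimes> s = b \<otimes> t"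
    using left_ore[of s t] st T_closed by blast
  have as: "a \<otimes> s \<in> T" using T_mult[OF ab(1) st(1)] .
  have e: "a \<otimes> r = b \<otimes> q"
    using fraction_eq_iff[of s t r q a b] eq ab as st T_closed by auto
  \<comment> \<open>The Ore condition gives \<open>b\<close> only as a ring element. In
    \<open>Q\<close> it equals \<open>(a s) t^-1\<close> with \<open>a \<otimes> s\<close> and
    \<open>t\<close> in \<open>T\<close>, so saturation and injectivity of \<open>j\<close> put it
    in \<open>T\<close>. Then \<open>d\<close> is unchanged by both multipliers in
    \<open>a \<otimes> r = b \<otimes> q\<close>.\<close>
  have "j b \<otimes>\<^bsub>Q\<^esub> j t \<otimes>\<^bsub>Q\<^esub> inv\<^bsub>Q\<^esub> (j t) = j b"
    using ab(2) T_closed[OF st(2)] units[OF st(2)] by (simp add: hom.S.m_assoc)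
  then have "right_fraction Q j (a \<otimes> s) t = j b"
    unfolding right_fraction_def ab(3) using ab(2) T_closed[OF st(2)] by simp
  then have "j b \<in> j ` T"
    using sat as st(2) ab(2) unfolding right_saturated_def by (metis imageI)
  then have "b \<in> T" using inj_iff ab(2) T_closed by auto
  then show ?thesis using inv[OF ab(1) st(3)] inv[OF _ st(4)] e by metis
qed

end

section \<open>Uniqueness of the ring of left fractions\<close>

text \<open>Whether two fractions agree, and which fraction is their sum or product, is decided
  inside \<open>A\<close> and \<open>T\<close> alone. Hence sending a fraction of \<open>P\<close>
  to the fraction of \<open>Q\<close> with the same denominator and numerator is well defined,
  injective and compatible with the operations.\<close>

lemma left_fractions_iso:
  assumes "left_fractions A P i T" "left_fractions A Q j T"
  shows "\<exists>f \<in> ring_iso P Q. \<forall>r \<in> carrier A. f (i r) = j r"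
proof -
  interpret P: left_fractions A P i T by fact
  interpret Q: left_fractions A Q j T by fact
  let ?G = "\<lambda>x y. \<exists>t\<in>T. \<exists>r\<in>carrier A. x = left_fraction P i t r \<and> y = left_fraction Q j t r"
  have eq: "left_fraction P i s r = left_fraction P i t q \<longleftrightarrow> left_fraction Q j s r = left_fraction Q j t q"
    if st: "s \<in> T" "t \<in> T" "r \<in> carrier A" "q \<in> carrier A" for s t r q
  proof -
    obtain a b where "a \<in> carrier A" "b \<in> carrier A" "a \<otimes>\<^bsub>A\<^esub> s \<in> T" "a \<otimes>\<^bsub>A\<^esub> s = b \<otimes>\<^bsub>A\<^esub> t"
      using P.common_denominator[OF st(1,2)] by metis
    then show ?thesis using P.fraction_eq_iff Q.fraction_eq_iff st by simp
  qed
  define f where "f x = (SOME y. ?G x y)" for x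
  have f: "f (left_fraction P i s r) = left_fraction Q j s r" if sr: "s \<in> T" "r \<in> carrier A" for s r
  proof -
    have "?G (left_fraction P i s r) (f (left_fraction P i s r))"
      unfolding f_def by (rule someI[of "?G _" "left_fraction Q j s r"]) (use sr in blast)
    then show ?thesis using eq[OF sr(1) _ sr(2)] by metis
  qed
  have fj: "f (i r) = j r" if "r \<in> carrier A" for r
    using f[OF P.T_one that] P.fraction_one[OF that] Q.fraction_one[OF that] by simp
  have closed: "f x \<in> carrier Q" if "x \<in> carrier P" for x
    using P.fractions[OF that] f Q.fraction_closed by auto
  have "f \<in> ring_iso P Q"
  proof (rule ring_iso_memI)
    show "f x \<in> carrier Q" if "x \<in> carrier P" for x by (rule closed[OF that])
  next
    fix x y assume xy: "x \<in> carrier P" "y \<in> carrier P"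
    then obtain s r q where s: "s \<in> T" "r \<in> carrier A" "q \<in> carrier A"
      "x = left_fraction P i s r" "y = left_fraction P i s q"
      using P.common_fractions by metis
    then show "f (x \<oplus>\<^bsub>P\<^esub> y) = f x \<oplus>\<^bsub>Q\<^esub> f y"
      using P.fraction_add Q.fraction_add f by simp
    \<comment> \<open>A single Ore pair \<open>u\<close>, \<open>b\<close> computes the product in
      both rings, so the two products are fractions with the same denominator and numerator.\<close>
    obtain u b where "u \<in> T" "b \<in> carrier A" "u \<otimes>\<^bsub>A\<^esub> r = b \<otimes>\<^bsub>A\<^esub> s"
      using P.left_ore[of r s] s by blast
    then show "f (x \<otimes>\<^bsub>P\<^esub> y) = f x \<otimes>\<^bsub>Q\<^esub> f y"
      using P.fraction_mult[of s s r q u b] Q.fraction_mult[of s s r q u b] f s P.T_mult by simp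
  next
    show "f \<one>\<^bsub>P\<^esub> = \<one>\<^bsub>Q\<^esub>" using fj[of "\<one>\<^bsub>A\<^esub>"] by simp
    show "bij_betw f (carrier P) (carrier Q)"
    proof (rule bij_betw_imageI)
      show "inj_on f (carrier P)"
      proof (rule inj_onI)
        fix x y assume xy: "x \<in> carrier P" "y \<in> carrier P" "f x = f y"
        obtain s r q where s: "s \<in> T" "r \<in> carrier A" "q \<in> carrier A"
          "x = left_fraction P i s r" "y = left_fraction P i s q"
          using P.common_fractions[OF xy(1,2)] .
        then show "x = y" using xy(3) f eq[OF s(1,1,2,3)] by simp
      qed
      show "f ` carrier P = carrier Q"
      proof (intro equalityI subsetI)
        fix y assume "y \<in> f ` carrier P"
        then show "y \<in> carrier Q" using closed by auto
      next
        fix y assume "y \<in> carrier Q"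
        then obtain t r where t: "t \<in> T" "r \<in> carrier A" "y = left_fraction Q j t r"
          using Q.fractions by blast
        show "y \<in> f ` carrier P"
          using imageI[OF P.fraction_closed[OF t(1,2)], of f] unfolding f[OF t(1,2)] t(3) .
      qed
    qed
  qed
  then show ?thesis using fj by blast
qed

section \<open>Opposite rings and the exchange of left and right\<close>

lemma opposite_ring_simps [simp]:
  "carrier (opposite_ring R) = carrier R"
  "\<one>\<^bsub>opposite_ring R\<^esub> = \<one>\<^bsub>R\<^esub>"
  "\<zero>\<^bsub>opposite_ring R\<^esub> = \<zero>\<^bsub>R\<^esub>"
  "x \<oplus>\<^bsub>opposite_ring R\<^esub> y = x \<oplus>\<^bsub>R\<^esub> y"
  "x \<otimes>\<^bsub>opposite_ring R\<^esub> y = y \<otimes>\<^bsub>R\<^esub> x"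
  "opposite_ring (opposite_ring R) = R"
  "Units (opposite_ring R) = Units R"
  unfolding opposite_ring_def Units_def by auto

lemma inv_opposite_ring [simp]: "inv\<^bsub>opposite_ring R\<^esub> x = inv\<^bsub>R\<^esub> x"
  unfolding m_inv_def by (simp add: conj_commute)

lemma left_fraction_opposite_ring [simp]:
  "left_fraction (opposite_ring Q) j s r = right_fraction Q j r s"
  unfolding left_fraction_def right_fraction_def by simp

lemma right_fraction_opposite_ring [simp]:
  "right_fraction (opposite_ring Q) j r s = left_fraction Q j s r"
  unfolding left_fraction_def right_fraction_def by simp

lemma left_ore_set_opposite_ring [simp]: "left_ore_set (opposite_ring R) S \<longleftrightarrow> right_ore_set R S"
  unfolding left_ore_set_def right_ore_set_def multiplicative_subset_def r_coset_def l_coset_def by auto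

lemma right_ore_set_opposite_ring [simp]: "right_ore_set (opposite_ring R) S \<longleftrightarrow> left_ore_set R S"
  using left_ore_set_opposite_ring[of "opposite_ring R"] by simp

lemma right_denominator_set_opposite_ring:
  "right_denominator_set R S \<longleftrightarrow> left_denominator_set (opposite_ring R) S"
  unfolding left_denominator_set_def right_denominator_set_def ass_l_def ass_r_def by simp

lemma ass_l_opposite_ring [simp]: "ass_l (opposite_ring R) S = ass_r R S"
  unfolding ass_l_def ass_r_def by simp

lemma Den_r_opposite_ring: "Den_r R I = Den_l (opposite_ring R) I"
  unfolding Den_r_def Den_l_def right_denominator_set_opposite_ring by simp

lemma right_euclidean_ring_opposite_ring:
  assumes "ring R"
  shows "right_euclidean_ring R d \<longleftrightarrow> left_euclidean_ring (opposite_ring R) d"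
  using assms opp_ring unfolding right_euclidean_ring_def left_euclidean_ring_def by auto

lemma right_saturated_opposite_ring [simp]:
  "right_saturated (opposite_ring A) T (opposite_ring Q) j \<longleftrightarrow> left_saturated A T Q j"
  unfolding right_saturated_def left_saturated_def by auto

lemma a_r_coset_opposite_ring [simp]: "a_r_coset (opposite_ring R) = a_r_coset R"
  by (auto simp: a_r_coset_def opposite_ring_def r_coset_def fun_eq_iff)

text \<open>Cosets and their sums involve only addition, and the product of two cosets is a union
  over pairs of representatives, so reversing the multiplication merely swaps the two factors.
  Equality of the records, rather than an isomorphism, lets right-handed quotient statements be
  obtained by rewriting.\<close>

lemma FactRing_opposite_ring [simp]: "opposite_ring R Quot I = opposite_ring (R Quot I)"
  unfolding FactRing_def opposite_ring_def A_RCOSETS_def RCOSETS_def a_r_coset_def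
    set_add_def set_mult_def rcoset_mult_def r_coset_def
  by (auto intro!: ext)

lemma ideal_opposite_ring:
  assumes "ideal I R"
  shows "ideal I (opposite_ring R)"
proof -
  interpret ideal I R by fact
  have "add_monoid (opposite_ring R) = add_monoid R"
    unfolding opposite_ring_def by simp
  then show ?thesis
    using opp_ring[OF ring_axioms] a_subgroup I_l_closed I_r_closed by (intro idealI) auto
qed

text \<open>By the right Ore condition \<open>r s' = s r'\<close>, a left fraction \<open>s\<^sup>-\<^sup>1 r\<close> is the right
  fraction \<open>r' s'\<^sup>-\<^sup>1\<close>.\<close>

lemma left_fractions_opposite_ring:
  assumes "left_fractions A Q j T" "right_ore_set A T"
  shows "left_fractions (opposite_ring A) (opposite_ring Q) j T"
proof -
  interpret left_fractions A Q j T by fact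
  have hom: "ring_hom_ring (opposite_ring A) (opposite_ring Q) j"
    by (rule ring_hom_ringI) (auto simp: opp_ring hom.R.ring_axioms hom.S.ring_axioms)
  show ?thesis
  proof (intro left_fractions.intro hom left_fractions_axioms.intro)
    show "left_ore_set (opposite_ring A) T" using assms by simp
    show "inj_on j (carrier (opposite_ring A))" using inj by simp
    show "t \<in> T \<Longrightarrow> j t \<in> Units (opposite_ring Q)" for t using units by simp
    fix x assume "x \<in> carrier (opposite_ring Q)"
    then obtain s r where s: "s \<in> T" "r \<in> carrier A" "x = left_fraction Q j s r"
      using fractions by (metis opposite_ring_simps(1))
    have "(r <#\<^bsub>A\<^esub> T) \<inter> (s <#\<^bsub>A\<^esub> carrier A) \<noteq> {}"
      using assms(2) s unfolding right_ore_set_def by blast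
    then obtain s' r' where s': "s' \<in> T" "r' \<in> carrier A" "r \<otimes>\<^bsub>A\<^esub> s' = s \<otimes>\<^bsub>A\<^esub> r'"
      unfolding l_coset_def by auto
    note cl = s(1)[THEN T_closed] s'(1)[THEN T_closed] s(2) s'(2) fraction_closed[OF s(1,2)]
    \<comment> \<open>Clearing \<open>s\<close> on the left and \<open>s'\<close> on the right
      reduces the claim to the Ore relation in \<open>A\<close>; afterwards the unit
      \<open>j s\<close> is cancelled.\<close>
    have "j s \<otimes>\<^bsub>Q\<^esub> (x \<otimes>\<^bsub>Q\<^esub> j s') = j s \<otimes>\<^bsub>Q\<^esub> j r'"
    proof -
      have "j s \<otimes>\<^bsub>Q\<^esub> (x \<otimes>\<^bsub>Q\<^esub> j s') = (j s \<otimes>\<^bsub>Q\<^esub> x) \<otimes>\<^bsub>Q\<^esub> j s'"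
        unfolding s(3) using cl by (simp add: hom.S.m_assoc)
      also have "\<dots> = j (r \<otimes>\<^bsub>A\<^esub> s')"
        unfolding s(3) mult_fraction[OF s(1,2)] using cl by simp
      finally show ?thesis unfolding s'(3) using cl by simp
    qed
    then have "x \<otimes>\<^bsub>Q\<^esub> j s' = j r'"
      using hom.S.Units_l_cancel[OF units[OF s(1)]] cl s(3) by simp
    then have "x = right_fraction Q j r' s'"
      unfolding right_fraction_def using cl s(3) units[OF s'(1)]
      by (metis hom.S.Units_inv_closed hom.S.Units_r_inv hom.S.m_assoc hom.S.r_one hom.hom_closed)
    then show "\<exists>t\<in>T. \<exists>r\<in>carrier (opposite_ring A). x = left_fraction (opposite_ring Q) j t r"
      using s' by auto
  qed
qed

section \<open>Euclidean functions on rings of fractions\<close>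

text \<open>The two denominators sit on opposite sides and can be cleared independently, one from
  the left and one from the right; injectivity of \<open>j\<close> brings the result back to
  \<open>A\<close>.\<close>

lemma left_fraction_eq_right_fraction_iff:
  assumes "left_fractions A Q j T" "s \<in> T" "t \<in> T" "r \<in> carrier A" "q \<in> carrier A"
  shows "left_fraction Q j s r = right_fraction Q j q t \<longleftrightarrow> r \<otimes>\<^bsub>A\<^esub> t = s \<otimes>\<^bsub>A\<^esub> q"
proof -
  interpret left_fractions A Q j T by fact
  let ?y = "right_fraction Q j q t"
  note cl = assms(2,3)[THEN T_closed] assms(4,5)
  have y: "?y \<in> carrier Q" and yt: "?y \<otimes>\<^bsub>Q\<^esub> j t = j q"
    using assms cl units[OF assms(3)] unfolding right_fraction_def by (auto simp: hom.S.m_assoc)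
  have "left_fraction Q j s r = ?y \<longleftrightarrow> j s \<otimes>\<^bsub>Q\<^esub> ?y = j r"
    using eq_fraction_iff[OF assms(2,4) y] by metis
  also have "\<dots> \<longleftrightarrow> (j s \<otimes>\<^bsub>Q\<^esub> ?y) \<otimes>\<^bsub>Q\<^esub> j t = j r \<otimes>\<^bsub>Q\<^esub> j t"
    using cl y units[OF assms(3)] by (metis hom.S.Units_inv_closed hom.S.Units_r_inv
        hom.S.m_assoc hom.S.m_closed hom.S.r_one hom.hom_closed)
  also have "\<dots> \<longleftrightarrow> j (s \<otimes>\<^bsub>A\<^esub> q) = j (r \<otimes>\<^bsub>A\<^esub> t)"
    using cl y yt by (simp add: hom.S.m_assoc)
  also have "\<dots> \<longleftrightarrow> r \<otimes>\<^bsub>A\<^esub> t = s \<otimes>\<^bsub>A\<^esub> q"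
    using inj_iff[of "s \<otimes>\<^bsub>A\<^esub> q" "r \<otimes>\<^bsub>A\<^esub> t"] cl hom.R.m_closed by metis
  finally show ?thesis .
qed

text \<open>Clearing denominators gives \<open>r t = s q\<close>, whence
  \<open>d r = d (r t) = d (s q) = d q\<close>. This uses invariance on the right for
  \<open>r\<close> and on the left for \<open>q\<close>.\<close>

lemma two_sided_fraction_value:
  assumes fr: "left_fractions A Q j T"
    and inv: "\<And>s r. s \<in> T \<Longrightarrow> r \<in> carrier A - {\<zero>\<^bsub>A\<^esub>} \<Longrightarrow>
      d (s \<otimes>\<^bsub>A\<^esub> r) = d r \<and> d (r \<otimes>\<^bsub>A\<^esub> s) = d r"
    and "s \<in> T" "t \<in> T" "r \<in> carrier A - {\<zero>\<^bsub>A\<^esub>}" "q \<in> carrier A - {\<zero>\<^bsub>A\<^esub>}"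
    and "left_fraction Q j s r = right_fraction Q j q t"
  shows "d r = d q"
proof -
  have "r \<otimes>\<^bsub>A\<^esub> t = s \<otimes>\<^bsub>A\<^esub> q"
    using left_fraction_eq_right_fraction_iff[OF fr, of s t r q] assms(3-) by simp
  then show ?thesis using inv[of t r] inv[of s q] assms(3-6) by metis
qed

text \<open>By the right Ore condition every element of \<open>Q\<close> is also a right fraction.
  Comparing left with right fractions serves twice: it makes \<delta> well defined, and it computes
  \<delta> on right fractions.\<close>

lemma two_sided_euclidean_fractions:
  fixes d :: "'b \<Rightarrow> 'p::order"
  assumes fr: "left_fractions A Q j T" and ore: "right_ore_set A T"
    and inv: "\<And>s r. s \<in> T \<Longrightarrow> r \<in> carrier A - {\<zero>\<^bsub>A\<^esub>} \<Longrightarrow>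
      d (s \<otimes>\<^bsub>A\<^esub> r) = d r \<and> d (r \<otimes>\<^bsub>A\<^esub> s) = d r"
    and euclid: "left_euclidean_ring A d"
  shows "(\<exists>\<delta>. \<forall>s\<in>T. \<forall>r \<in> carrier A - {\<zero>\<^bsub>A\<^esub>}. \<delta> (left_fraction Q j s r) = d r) \<and>
    (\<forall>\<delta>. (\<forall>s\<in>T. \<forall>r \<in> carrier A - {\<zero>\<^bsub>A\<^esub>}. \<delta> (left_fraction Q j s r) = d r) \<longrightarrow>
      left_euclidean_ring Q \<delta> \<and>
      (\<forall>s\<in>T. \<forall>r \<in> carrier A - {\<zero>\<^bsub>A\<^esub>}. \<delta> (right_fraction Q j r s) = d r))"
proof -
  interpret left_fractions A Q j T by fact
  interpret op: left_fractions "opposite_ring A" "opposite_ring Q" j T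
    by (rule left_fractions_opposite_ring[OF fr ore])
  note val = two_sided_fraction_value[where d = d, OF fr inv]
  have "\<exists>\<delta>. \<forall>s\<in>T. \<forall>r \<in> carrier A - {\<zero>\<^bsub>A\<^esub>}. \<delta> (left_fraction Q j s r) = d r"
  proof (rule ex_fraction_function)
    fix s t r q assume st: "s \<in> T" "t \<in> T" "r \<in> carrier A - {\<zero>\<^bsub>A\<^esub>}" "q \<in> carrier A - {\<zero>\<^bsub>A\<^esub>}"
      and eq: "left_fraction Q j s r = left_fraction Q j t q"
    \<comment> \<open>Two left fractions are not compared directly: a right fraction for their
      common value links \<open>r\<close> to \<open>q'\<close> and \<open>q'\<close> to
      \<open>q\<close>.\<close>
    obtain t' q' where t': "t' \<in> T" "q' \<in> carrier A" "left_fraction Q j s r = right_fraction Q j q' t'"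
      using op.fractions[of "left_fraction Q j s r"] fraction_closed[of s r] st by auto
    have "q' \<in> carrier A - {\<zero>\<^bsub>A\<^esub>}"
      using op.fraction_zero_iff[of t' q'] fraction_zero_iff[of s r] t' st by auto
    then show "d r = d q" using val[of s t' r q'] val[of t t' q q'] st eq t' by simp
  qed
  moreover have "left_euclidean_ring Q \<delta> \<and>
      (\<forall>s\<in>T. \<forall>r \<in> carrier A - {\<zero>\<^bsub>A\<^esub>}. \<delta> (right_fraction Q j r s) = d r)"
    if \<delta>: "\<forall>s\<in>T. \<forall>r \<in> carrier A - {\<zero>\<^bsub>A\<^esub>}. \<delta> (left_fraction Q j s r) = d r" for \<delta>
  proof (intro conjI ballI)
    show "left_euclidean_ring Q \<delta>" using left_euclidean_fractions[OF euclid] \<delta> by blast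
    fix s r assume sr: "s \<in> T" "r \<in> carrier A - {\<zero>\<^bsub>A\<^esub>}"
    obtain t q where t: "t \<in> T" "q \<in> carrier A" "right_fraction Q j r s = left_fraction Q j t q"
      using fractions[of "right_fraction Q j r s"] op.fraction_closed[of s r] sr by auto
    have "q \<in> carrier A - {\<zero>\<^bsub>A\<^esub>}"
      using op.fraction_zero_iff[of s r] fraction_zero_iff[of t q] t sr by auto
    then show "\<delta> (right_fraction Q j r s) = d r"
      using val[of t s q r] \<delta> t sr by simp
  qed
  ultimately show ?thesis by blast
qed

lemma saturated_euclidean_fractions:
  fixes d :: "'b \<Rightarrow> 'p::order"
  assumes fr: "left_fractions A Q j T"
    and sat: "right_saturated A T Q j"
    and inv: "\<And>s r. s \<in> T \<Longrightarrow> r \<in> carrier A - {\<zero>\<^bsub>A\<^esub>} \<Longrightarrow> d (s \<otimes>\<^bsub>A\<^esub> r) = d r"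
    and euclid: "left_euclidean_ring A d"
  shows "(\<exists>\<delta>. \<forall>s\<in>T. \<forall>r \<in> carrier A - {\<zero>\<^bsub>A\<^esub>}. \<delta> (left_fraction Q j s r) = d r) \<and>
    (\<forall>\<delta>. (\<forall>s\<in>T. \<forall>r \<in> carrier A - {\<zero>\<^bsub>A\<^esub>}. \<delta> (left_fraction Q j s r) = d r) \<longrightarrow>
      left_euclidean_ring Q \<delta>)"
proof -
  interpret left_fractions A Q j T by fact
  have "\<exists>\<delta>. \<forall>s\<in>T. \<forall>r \<in> carrier A - {\<zero>\<^bsub>A\<^esub>}. \<delta> (left_fraction Q j s r) = d r"
    by (rule ex_fraction_function) (rule saturated_consistent[where d = d, OF sat inv])
  then show ?thesis using left_euclidean_fractions[OF euclid] by blast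
qed

section \<open>Ore localization without torsion\<close>

text \<open>The kernel of the localization map is \<open>ass_l A T\<close>; its vanishing supplies
  the injectivity demanded of the embedding.\<close>

lemma left_fractions_left_localization:
  assumes "ring A" "left_denominator_set A T" "ass_l A T = {\<zero>\<^bsub>A\<^esub>}"
  shows "left_fractions A (left_localization A T) (left_localization_map A T) T"
proof -
  interpret left_den A T using assms by (intro left_den.intro left_den_axioms.intro)
  interpret H: ring_hom_ring A "left_localization A T" "left_localization_map A T"
    by (rule ring_hom_ringI2[OF ring_axioms Q_ring map_hom])
  show ?thesis
  proof (intro left_fractions.intro left_fractions_axioms.intro H.is_ring_hom_ring)
    show "left_ore_set A T" using den unfolding left_denominator_set_def by simp
    show "left_localization_map A T t \<in> Units (left_localization A T)" if "t \<in> T" for t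
      by (rule map_Units(1)[OF that])
    show "\<exists>t\<in>T. \<exists>r\<in>carrier A. x = left_fraction (left_localization A T) (left_localization_map A T) t r"
      if "x \<in> carrier (left_localization A T)" for x
      using carrier_F[OF that] lfrac_eq by metis
    have "a_kernel A (left_localization A T) (left_localization_map A T) = {\<zero>\<^bsub>A\<^esub>}"
      unfolding a_kernel_def' using map_kernel assms(3) by auto
    then show "inj_on (left_localization_map A T) (carrier A)"
      by (rule H.trivial_ker_imp_inj)
  qed
qed

section \<open>Euclidean functions and denominator sets modulo an ideal\<close>

context ideal
begin

lemma FactRing_carrier_iff: "X \<in> carrier (R Quot I) \<longleftrightarrow> (\<exists>x\<in>carrier R. X = I +> x)"
  unfolding FactRing_def A_RCOSETS_def' by auto

lemma rcos_in_carrier: "x \<in> carrier R \<Longrightarrow> I +> x \<in> carrier (R Quot I)"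
  using FactRing_carrier_iff by auto

lemma rcos_eq_zero_iff: "x \<in> carrier R \<Longrightarrow> I +> x = \<zero>\<^bsub>R Quot I\<^esub> \<longleftrightarrow> x \<in> I"
  unfolding FactRing_def using a_rcos_zero[OF is_ideal, of x] rcos_const_imp_mem[of x] by (simp, blast)

lemma rcos_mult: "x \<in> carrier R \<Longrightarrow> y \<in> carrier R \<Longrightarrow> (I +> x) \<otimes>\<^bsub>R Quot I\<^esub> (I +> y) = I +> (x \<otimes> y)"
  unfolding FactRing_def using rcoset_mult_add by simp

lemma rcos_add: "x \<in> carrier R \<Longrightarrow> y \<in> carrier R \<Longrightarrow> (I +> x) \<oplus>\<^bsub>R Quot I\<^esub> (I +> y) = I +> (x \<oplus> y)"
  unfolding FactRing_def using a_rcos_sum by simp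

lemma rcos_memD: "x \<in> carrier R \<Longrightarrow> y \<in> I +> x \<Longrightarrow> y \<in> carrier R \<and> I +> y = I +> x"
  using a_repr_independence'[of y x] a_elemrcos_carrier[of x y] by simp

text \<open>A least value over a coset is unique by antisymmetry, so \<open>LEAST\<close> returns
  the value at any minimizer. The minimizer lies in the coset and therefore also represents
  it.\<close>

lemma quotient_fun_attained:
  assumes "has_quotient_minima R I d" "X \<in> carrier (R Quot I) - {\<zero>\<^bsub>R Quot I\<^esub>}"
  obtains x where "x \<in> carrier R" "X = I +> x" "quotient_fun d X = d x" "\<And>y. y \<in> X \<Longrightarrow> d x \<le> d y"
proof -
  have "\<exists>x\<in>X. \<forall>y\<in>X. d x \<le> d y"
    using assms unfolding has_quotient_minima_def by (rule bspec)
  then obtain x where x: "x \<in> X" "\<And>y. y \<in> X \<Longrightarrow> d x \<le> d y" by auto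
  then have d: "quotient_fun d X = d x"
    unfolding quotient_fun_def by (intro Least_equality) auto
  obtain z where z: "z \<in> carrier R" "X = I +> z"
    using assms(2) FactRing_carrier_iff[of X] by auto
  have "x \<in> carrier R \<and> I +> x = I +> z"
    by (rule rcos_memD[OF z(1) x(1)[unfolded z(2)]])
  then have x_rep: "x \<in> carrier R" "X = I +> x"
    using z(2) by simp_all
  show ?thesis by (rule that[OF x_rep d x(2)])
qed

lemma left_euclidean_quotient:
  fixes d :: "'a \<Rightarrow> 'p::order"
  assumes euclid: "left_euclidean_ring R d" and minima: "has_quotient_minima R I d"
  shows "left_euclidean_ring (R Quot I) (quotient_fun d)"
  unfolding left_euclidean_ring_def
proof (intro conjI ballI)
  let ?B = "R Quot I"
  show "ring ?B" by (rule quotient_is_ring)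
  have nonzero: "x \<noteq> \<zero>" if "I +> x \<noteq> \<zero>\<^bsub>?B\<^esub>" for x
    using that rcos_eq_zero_iff[of \<zero>] by auto
  have "quotient_fun d ` (carrier ?B - {\<zero>\<^bsub>?B\<^esub>}) \<subseteq> d ` (carrier R - {\<zero>})"
  proof
    fix p assume "p \<in> quotient_fun d ` (carrier ?B - {\<zero>\<^bsub>?B\<^esub>})"
    then obtain X where X: "X \<in> carrier ?B - {\<zero>\<^bsub>?B\<^esub>}" "p = quotient_fun d X" by blast
    obtain x where "x \<in> carrier R" "X = I +> x" "quotient_fun d X = d x"
      using quotient_fun_attained[OF minima X(1)] by metis
    then show "p \<in> d ` (carrier R - {\<zero>})" using X nonzero by auto
  qed
  then show "artinian_poset (quotient_fun d ` (carrier ?B - {\<zero>\<^bsub>?B\<^esub>}))"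
    using euclid unfolding left_euclidean_ring_def artinian_poset_def by blast
  fix X Y assume X: "X \<in> carrier ?B - {\<zero>\<^bsub>?B\<^esub>}" and Y: "Y \<in> carrier ?B - {\<zero>\<^bsub>?B\<^esub>}"
  obtain x where x: "x \<in> carrier R" "X = I +> x" using X FactRing_carrier_iff[of X] by auto
  \<comment> \<open>The dividend may be any representative. The divisor has to be a minimizer, so
    that \<open>d r < d y\<close> bounds the remainder by the quotient value of
    \<open>Y\<close>.\<close>
  obtain y where y: "y \<in> carrier R" "Y = I +> y" "quotient_fun d Y = d y"
    using quotient_fun_attained[OF minima Y] by metis
  have "x \<in> carrier R - {\<zero>}" "y \<in> carrier R - {\<zero>}" using x y X Y nonzero by auto
  then obtain q r where q: "q \<in> carrier R" "r \<in> carrier R" "x = q \<otimes> y \<oplus> r" "r = \<zero> \<or> d r < d y"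
    using euclid unfolding left_euclidean_ring_def by meson
  have "X = (I +> q) \<otimes>\<^bsub>?B\<^esub> Y \<oplus>\<^bsub>?B\<^esub> (I +> r)"
    using x(2) y(1,2) q(1-3) by (simp add: rcos_mult rcos_add)
  moreover have "I +> r = \<zero>\<^bsub>?B\<^esub> \<or> quotient_fun d (I +> r) < quotient_fun d Y"
  proof (cases "I +> r = \<zero>\<^bsub>?B\<^esub>")
    case False
    then obtain r' where r': "quotient_fun d (I +> r) = d r'" "\<And>z. z \<in> I +> r \<Longrightarrow> d r' \<le> d z"
      using quotient_fun_attained[OF minima, of "I +> r"] rcos_in_carrier[OF q(2)] False
      by (metis DiffI singletonD)
    \<comment> \<open>Passing from \<open>r\<close> to its coset can only lower the value, so the
      strict bound survives.\<close>
    have "d r' \<le> d r" using r'(2) a_rcos_self[OF q(2)] by blast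
    also have "d r < d y" using q(4) nonzero False by blast
    finally show ?thesis using r' y by simp
  qed simp
  ultimately show "\<exists>q\<in>carrier ?B. \<exists>r\<in>carrier ?B. X = q \<otimes>\<^bsub>?B\<^esub> Y \<oplus>\<^bsub>?B\<^esub> r \<and>
      (r = \<zero>\<^bsub>?B\<^esub> \<or> quotient_fun d r < quotient_fun d Y)"
    using rcos_in_carrier[OF q(1)] rcos_in_carrier[OF q(2)] by (intro bexI conjI)
qed

text \<open>Modulo \<open>ass_l R S\<close> the images of elements of \<open>S\<close> are regular
  on both sides, which gives the vanishing of \<open>ass_l\<close> and the denominator condition.
  The Ore relation is simply projected.\<close>

lemma left_denominator_quotient:
  assumes "S \<in> Den_l R I"
  shows "left_denominator_set (R Quot I) ((+>) I ` S)"
    and "ass_l (R Quot I) ((+>) I ` S) = {\<zero>\<^bsub>R Quot I\<^esub>}"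
proof -
  let ?B = "R Quot I" and ?T = "(+>) I ` S"
  interpret left_den R S
    using assms ring_axioms unfolding Den_l_def by (intro left_den.intro left_den_axioms.intro) auto
  have I: "x \<in> I \<longleftrightarrow> x \<in> carrier R \<and> (\<exists>s\<in>S. s \<otimes> x = \<zero>)" for x
    using assms unfolding Den_l_def ass_l_def by auto
  have zero_notin: "\<zero> \<notin> S"
    using den unfolding left_denominator_set_def left_ore_set_def multiplicative_subset_def by simp
  have mult_in: "x \<in> I" if x: "s \<in> S" "x \<in> carrier R" "s \<otimes> x \<in> I" for s x
  proof -
    obtain t where "t \<in> S" "t \<otimes> (s \<otimes> x) = \<zero>" using I x by blast
    then have "(t \<otimes> s) \<otimes> x = \<zero>" "t \<otimes> s \<in> S" using x S_sub S_mult by (auto simp: m_assoc)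
    then show ?thesis using I x by blast
  qed
  have in_mult: "x \<in> I" if x: "s \<in> S" "x \<in> carrier R" "x \<otimes> s \<in> I" for s x
  proof -
    \<comment> \<open>Torsion of \<open>x \<otimes> s\<close> is turned by the denominator condition
      into torsion of \<open>t \<otimes> x\<close>; the left factor \<open>t\<close> is then removed
      by \<open>mult_in\<close>.\<close>
    obtain t where t: "t \<in> S" "t \<otimes> (x \<otimes> s) = \<zero>" using I x by blast
    then have "(t \<otimes> x) \<otimes> s = \<zero>" using x S_sub by (simp add: m_assoc)
    then have "t \<otimes> x \<in> I"
      using den assms x t S_sub unfolding left_denominator_set_def Den_l_def by auto
    then show ?thesis using mult_in t x by blast
  qed
  \<comment> \<open>An element \<open>s\<close> of both sets would satisfy \<open>t s = 0\<close>
    for some \<open>t\<close> in \<open>S\<close>, and closure under products would put zero into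
    \<open>S\<close>.\<close>
  have disjoint: "s \<notin> I" if "s \<in> S" for s
    using that I S_mult zero_notin by metis
  have one: "\<one>\<^bsub>?B\<^esub> = I +> \<one>" unfolding FactRing_def by simp
  show ass: "ass_l ?B ?T = {\<zero>\<^bsub>?B\<^esub>}"
  proof (intro equalityI subsetI)
    fix X assume "X \<in> ass_l ?B ?T"
    then obtain x s where x: "x \<in> carrier R" "X = I +> x" "s \<in> S" "(I +> s) \<otimes>\<^bsub>?B\<^esub> X = \<zero>\<^bsub>?B\<^esub>"
      unfolding ass_l_def FactRing_carrier_iff by auto
    then have "s \<otimes> x \<in> I" using rcos_mult rcos_eq_zero_iff S_sub by auto
    then show "X \<in> {\<zero>\<^bsub>?B\<^esub>}" using mult_in x rcos_eq_zero_iff by auto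
  next
    interpret B: ring ?B by (rule quotient_is_ring)
    fix X assume "X \<in> {\<zero>\<^bsub>?B\<^esub>}"
    then show "X \<in> ass_l ?B ?T"
      unfolding ass_l_def using S_one one B.r_null[OF B.one_closed] by auto
  qed
  have "multiplicative_subset ?B ?T"
    unfolding multiplicative_subset_def
  proof (intro conjI ballI)
    show "?T \<subseteq> carrier ?B" using rcos_in_carrier S_sub by blast
    show "\<one>\<^bsub>?B\<^esub> \<in> ?T" unfolding one using S_one by blast
    show "\<zero>\<^bsub>?B\<^esub> \<notin> ?T" using disjoint rcos_eq_zero_iff S_sub by (metis imageE)
    show "X \<otimes>\<^bsub>?B\<^esub> Y \<in> ?T" if "X \<in> ?T" "Y \<in> ?T" for X Y
      using that rcos_mult S_sub S_mult by auto
  qed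
  moreover have "(?T #>\<^bsub>?B\<^esub> X) \<inter> (carrier ?B #>\<^bsub>?B\<^esub> Y) \<noteq> {}" if "X \<in> carrier ?B" "Y \<in> ?T" for X Y
  proof -
    obtain x s where x: "x \<in> carrier R" "X = I +> x" "s \<in> S" "Y = I +> s"
      using \<open>X \<in> carrier ?B\<close> \<open>Y \<in> ?T\<close> FactRing_carrier_iff[of X] by auto
    obtain u b where u: "u \<in> S" "b \<in> carrier R" "u \<otimes> x = b \<otimes> s" using ore[OF x(1,3)] by blast
    have "(I +> u) \<otimes>\<^bsub>?B\<^esub> X = (I +> b) \<otimes>\<^bsub>?B\<^esub> Y"
      using x u S_sub by (simp add: rcos_mult)
    then show ?thesis
      unfolding r_coset_def using u rcos_in_carrier by blast
  qed
  moreover have "X \<in> ass_l ?B ?T"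
    if XY: "X \<in> carrier ?B" "Y \<in> ?T" "X \<otimes>\<^bsub>?B\<^esub> Y = \<zero>\<^bsub>?B\<^esub>" for X Y
  proof -
    obtain x s where x: "x \<in> carrier R" "X = I +> x" "s \<in> S" "Y = I +> s"
      using XY(1,2) FactRing_carrier_iff[of X] by auto
    then have "x \<otimes> s \<in> I" using XY(3) rcos_mult rcos_eq_zero_iff S_sub by auto
    then show ?thesis unfolding ass using in_mult x rcos_eq_zero_iff by auto
  qed
  ultimately show "left_denominator_set ?B ?T"
    unfolding left_denominator_set_def left_ore_set_def by blast
qed

text \<open>The kernel of the map from \<open>R\<close> to \<open>S^-1 R\<close> is
  \<open>I\<close>, so by the homomorphism theorem the induced map embeds \<open>R/I\<close>. Thus
  the localization of \<open>R\<close> itself is a ring of left fractions of \<open>R/I\<close>,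
  directly comparable with the localization of \<open>R/I\<close>.\<close>

lemma
  assumes "S \<in> Den_l R I"
  shows left_localization_quot_map_rcos:
      "\<And>r. r \<in> carrier R \<Longrightarrow> left_localization_quot_map R S (I +> r) = left_localization_map R S r"
    and left_fractions_quot_map:
      "left_fractions (R Quot I) (left_localization R S) (left_localization_quot_map R S) ((+>) I ` S)"
proof -
  let ?Q = "left_localization R S" and ?h = "left_localization_map R S"
    and ?j = "left_localization_quot_map R S"
  interpret left_den R S
    using assms ring_axioms unfolding Den_l_def by (intro left_den.intro left_den_axioms.intro) auto
  interpret H: ring_hom_ring R ?Q ?h
    by (rule ring_hom_ringI2[OF ring_axioms Q_ring map_hom])
  have ker: "a_kernel R ?Q ?h = I"
    unfolding a_kernel_def' using map_kernel assms unfolding Den_l_def ass_l_def by auto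
  have j: "?j = (\<lambda>X. the_elem (?h ` X))"
    unfolding left_localization_quot_map_def by (rule refl)
  have jh: "?j (I +> r) = ?h r" if "r \<in> carrier R" for r
    unfolding j using H.the_elem_simp[OF that] unfolding ker .
  then show "\<And>r. r \<in> carrier R \<Longrightarrow> ?j (I +> r) = ?h r" .
  have J: "ring_hom_ring (R Quot I) ?Q ?j"
    using ring_hom_ringI2[OF quotient_is_ring Q_ring] H.the_elem_hom unfolding ker j by blast
  show "left_fractions (R Quot I) ?Q ?j ((+>) I ` S)"
  proof (intro left_fractions.intro left_fractions_axioms.intro J)
    show "left_ore_set (R Quot I) ((+>) I ` S)"
      using left_denominator_quotient(1)[OF assms] unfolding left_denominator_set_def by simp
    show "?j t \<in> Units ?Q" if "t \<in> (+>) I ` S" for t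
      using that jh map_Units(1) S_sub by auto
    show "inj_on ?j (carrier (R Quot I))"
      using H.the_elem_inj unfolding ker j by (intro inj_onI) blast
    fix x assume "x \<in> carrier ?Q"
    then obtain s r where s: "s \<in> S" "r \<in> carrier R" "x = lfrac R S s r" by (rule carrier_F)
    have "x = left_fraction ?Q ?j (I +> s) (I +> r)"
      using lfrac_eq[OF s(1,2)] s jh S_sub unfolding left_fraction_def by simp
    then show "\<exists>t\<in>(+>) I ` S. \<exists>r\<in>carrier (R Quot I). x = left_fraction ?Q ?j t r"
      using s rcos_in_carrier by blast
  qed
qed

end

section \<open>The theorem from its left-handed form and opposite rings\<close>

lemma has_quotient_minima_opposite_ring [simp]:
  "has_quotient_minima (opposite_ring R) I d \<longleftrightarrow> has_quotient_minima R I d"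
  unfolding has_quotient_minima_def by simp

text \<open>The formula fixes \<delta> only on nonzero elements. Hence existence of \<delta>
  expresses well-definedness, and the Euclidean property is claimed for every total function
  satisfying the formula. The isomorphisms are required to respect the canonical maps.\<close>

theorem theorem2p17:
  fixes R :: "('a, 'm) ring_scheme" and \<aa> S :: "'a set" and d :: "'a \<Rightarrow> 'p::order"
    and Rbar :: "'a set ring" and Sbar :: "'a set set" and dbar :: "'a set \<Rightarrow> 'p"
    and SR SbarRbar RbarSbar :: "_ ring" and \<pi> :: "'a \<Rightarrow> 'a set"
    and j :: "'a set \<Rightarrow> ('a \<times> 'a) set" and k :: "'a set \<Rightarrow> ('a set \<times> 'a set) set"
  assumes "ring R" and "ideal \<aa> R"
    and "Rbar = R Quot \<aa>"
    and "\<pi> = (\<lambda>r. \<aa> +>\<^bsub>R\<^esub> r)"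
    and "Sbar = \<pi> ` S"
    and "dbar = quotient_fun d"
    and "SR = left_localization R S"
    and "SbarRbar = left_localization Rbar Sbar"
    and "RbarSbar = right_localization Rbar Sbar"
    and "j = left_localization_quot_map R S"
    and "k = right_localization_map Rbar Sbar"
    and minima: "has_quotient_minima R \<aa> d"
  shows
    \<comment> \<open>(1), left version\<close>
    "(left_euclidean_ring R d \<and> S \<in> Den R \<aa> \<longrightarrow>
        left_euclidean_ring Rbar dbar \<and>
        ((\<forall>s \<in> Sbar. \<forall>r \<in> carrier Rbar - {\<zero>\<^bsub>Rbar\<^esub>}.
            dbar (s \<otimes>\<^bsub>Rbar\<^esub> r) = dbar r \<and> dbar (r \<otimes>\<^bsub>Rbar\<^esub> s) = dbar r) \<longrightarrow>
          (\<exists>f \<in> ring_iso SR SbarRbar. \<forall>r \<in> carrier R.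
             f (left_localization_map R S r) = left_localization_map Rbar Sbar (\<pi> r)) \<and>
          (\<exists>g \<in> ring_iso SbarRbar RbarSbar. \<forall>x \<in> carrier Rbar.
             g (left_localization_map Rbar Sbar x) = k x) \<and>
          (\<exists>\<delta> :: ('a \<times> 'a) set \<Rightarrow> 'p. \<forall>s \<in> Sbar. \<forall>r \<in> carrier Rbar - {\<zero>\<^bsub>Rbar\<^esub>}.
             \<delta> (left_fraction SR j s r) = dbar r) \<and>
          (\<forall>\<delta> :: ('a \<times> 'a) set \<Rightarrow> 'p.
             (\<forall>s \<in> Sbar. \<forall>r \<in> carrier Rbar - {\<zero>\<^bsub>Rbar\<^esub>}.
                \<delta> (left_fraction SR j s r) = dbar r) \<longrightarrow>
             left_euclidean_ring SR \<delta> \<and>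
             (\<forall>s \<in> Sbar. \<forall>r \<in> carrier Rbar - {\<zero>\<^bsub>Rbar\<^esub>}.
                \<delta> (right_fraction SR j r s) = dbar r)))) \<and>
    \<comment> \<open>(1), right version\<close>
     (right_euclidean_ring R d \<and> S \<in> Den R \<aa> \<longrightarrow>
        right_euclidean_ring Rbar dbar \<and>
        ((\<forall>s \<in> Sbar. \<forall>r \<in> carrier Rbar - {\<zero>\<^bsub>Rbar\<^esub>}.
            dbar (s \<otimes>\<^bsub>Rbar\<^esub> r) = dbar r \<and> dbar (r \<otimes>\<^bsub>Rbar\<^esub> s) = dbar r) \<longrightarrow>
          (\<exists>f \<in> ring_iso SR SbarRbar. \<forall>r \<in> carrier R.
             f (left_localization_map R S r) = left_localization_map Rbar Sbar (\<pi> r)) \<and>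
          (\<exists>g \<in> ring_iso SbarRbar RbarSbar. \<forall>x \<in> carrier Rbar.
             g (left_localization_map Rbar Sbar x) = k x) \<and>
          (\<exists>\<delta> :: ('a \<times> 'a) set \<Rightarrow> 'p. \<forall>s \<in> Sbar. \<forall>r \<in> carrier Rbar - {\<zero>\<^bsub>Rbar\<^esub>}.
             \<delta> (right_fraction SR j r s) = dbar r) \<and>
          (\<forall>\<delta> :: ('a \<times> 'a) set \<Rightarrow> 'p.
             (\<forall>s \<in> Sbar. \<forall>r \<in> carrier Rbar - {\<zero>\<^bsub>Rbar\<^esub>}.
                \<delta> (right_fraction SR j r s) = dbar r) \<longrightarrow>
             right_euclidean_ring SR \<delta> \<and>
             (\<forall>s \<in> Sbar. \<forall>r \<in> carrier Rbar - {\<zero>\<^bsub>Rbar\<^esub>}.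
                \<delta> (left_fraction SR j s r) = dbar r)))) \<and>
    \<comment> \<open>(2)\<close>
     (left_euclidean_ring R d \<and> S \<in> Den_l R \<aa> \<longrightarrow>
        left_euclidean_ring Rbar dbar \<and>
        (right_saturated Rbar Sbar SR j \<and>
         (\<forall>s \<in> Sbar. \<forall>r \<in> carrier Rbar - {\<zero>\<^bsub>Rbar\<^esub>}. dbar (s \<otimes>\<^bsub>Rbar\<^esub> r) = dbar r) \<longrightarrow>
          (\<exists>\<delta> :: ('a \<times> 'a) set \<Rightarrow> 'p. \<forall>s \<in> Sbar. \<forall>r \<in> carrier Rbar - {\<zero>\<^bsub>Rbar\<^esub>}.
             \<delta> (left_fraction SR j s r) = dbar r) \<and>
          (\<forall>\<delta> :: ('a \<times> 'a) set \<Rightarrow> 'p.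
             (\<forall>s \<in> Sbar. \<forall>r \<in> carrier Rbar - {\<zero>\<^bsub>Rbar\<^esub>}.
                \<delta> (left_fraction SR j s r) = dbar r) \<longrightarrow>
             left_euclidean_ring SR \<delta>))) \<and>
    \<comment> \<open>(3)\<close>
     (right_euclidean_ring R d \<and> S \<in> Den_r R \<aa> \<longrightarrow>
        right_euclidean_ring Rbar dbar \<and>
        (left_saturated Rbar Sbar RbarSbar k \<and>
         (\<forall>s \<in> Sbar. \<forall>r \<in> carrier Rbar - {\<zero>\<^bsub>Rbar\<^esub>}. dbar (r \<otimes>\<^bsub>Rbar\<^esub> s) = dbar r) \<longrightarrow>
          (\<exists>\<delta> :: ('a set \<times> 'a set) set \<Rightarrow> 'p. \<forall>s \<in> Sbar. \<forall>r \<in> carrier Rbar - {\<zero>\<^bsub>Rbar\<^esub>}.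
             \<delta> (right_fraction RbarSbar k r s) = dbar r) \<and>
          (\<forall>\<delta> :: ('a set \<times> 'a set) set \<Rightarrow> 'p.
             (\<forall>s \<in> Sbar. \<forall>r \<in> carrier Rbar - {\<zero>\<^bsub>Rbar\<^esub>}.
                \<delta> (right_fraction RbarSbar k r s) = dbar r) \<longrightarrow>
             right_euclidean_ring RbarSbar \<delta>)))"
proof -
  interpret ideal \<aa> R by fact
  interpret op: ideal \<aa> "opposite_ring R" by (rule ideal_opposite_ring) fact
  have \<pi>: "\<pi> = (+>\<^bsub>R\<^esub>) \<aa>" using assms(4) by simp
  have Rbar: "ring Rbar" unfolding assms(3) by (rule quotient_is_ring)
  have quot_l: "left_euclidean_ring Rbar dbar" if "left_euclidean_ring R d"
    unfolding assms(3,6) by (rule left_euclidean_quotient[OF that minima])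
  \<comment> \<open>Right division is left division in the opposite ring, and forming the quotient
    commutes with taking opposites.\<close>
  have quot_r: "right_euclidean_ring Rbar dbar" if "right_euclidean_ring R d"
    using op.left_euclidean_quotient[of d] that minima Rbar
    unfolding right_euclidean_ring_opposite_ring[OF Rbar] right_euclidean_ring_opposite_ring[OF \<open>ring R\<close>]
    unfolding assms(3,6) by simp
  have den_l: "left_denominator_set Rbar Sbar" "ass_l Rbar Sbar = {\<zero>\<^bsub>Rbar\<^esub>}" if "S \<in> Den_l R \<aa>"
    unfolding assms(3,5) \<pi> by (rule left_denominator_quotient[OF that])+
  have den_r: "left_denominator_set (opposite_ring Rbar) Sbar"
      "ass_l (opposite_ring Rbar) Sbar = {\<zero>\<^bsub>opposite_ring Rbar\<^esub>}" if "S \<in> Den_r R \<aa>"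
    using op.left_denominator_quotient[of S] that unfolding Den_r_opposite_ring assms(3,5) \<pi> by simp_all
  have SR: "left_fractions Rbar SR j Sbar" if "S \<in> Den_l R \<aa>"
    unfolding assms(3,5,7,10) \<pi> by (rule left_fractions_quot_map[OF that])
  have SbarRbar: "left_fractions Rbar SbarRbar (left_localization_map Rbar Sbar) Sbar"
    if "S \<in> Den_l R \<aa>"
    unfolding assms(8) by (rule left_fractions_left_localization[OF Rbar den_l[OF that]])
  \<comment> \<open>By definition \<open>RbarSbar\<close> is the opposite of a left localization of
    \<open>opposite_ring Rbar\<close>, so its own opposite is that left localization.\<close>
  have RbarSbar: "left_fractions (opposite_ring Rbar) (opposite_ring RbarSbar) k Sbar"
    if "S \<in> Den_r R \<aa>"
    using left_fractions_left_localization[OF opp_ring[OF Rbar] den_r[OF that]]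
    unfolding assms(9,11) right_localization_def right_localization_map_def by simp
  have ore_r: "right_ore_set Rbar Sbar" if "S \<in> Den_r R \<aa>"
    using den_r(1)[OF that] unfolding left_denominator_set_def by simp
  \<comment> \<open>Uniqueness applies because \<open>SR\<close> and \<open>SbarRbar\<close> are
    both rings of left fractions of \<open>Rbar\<close> at \<open>Sbar\<close>. Since
    \<open>j (\<pi> r)\<close> is the image of \<open>r\<close>, compatibility over
    \<open>Rbar\<close> becomes compatibility over \<open>R\<close>.\<close>
  have iso1: "\<exists>f \<in> ring_iso SR SbarRbar. \<forall>r \<in> carrier R.
      f (left_localization_map R S r) = left_localization_map Rbar Sbar (\<pi> r)" if S: "S \<in> Den_l R \<aa>"
  proof -
    obtain f where f: "f \<in> ring_iso SR SbarRbar"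
        "\<And>x. x \<in> carrier Rbar \<Longrightarrow> f (j x) = left_localization_map Rbar Sbar x"
      using left_fractions_iso[OF SR[OF S] SbarRbar[OF S]] by auto
    have "f (left_localization_map R S r) = left_localization_map Rbar Sbar (\<pi> r)"
      if r: "r \<in> carrier R" for r
      using f(2)[of "\<pi> r"] rcos_in_carrier[OF r] left_localization_quot_map_rcos[OF S r]
      unfolding assms(3,10) \<pi> by simp
    then show ?thesis using f(1) by auto
  qed
  have iso2: "\<exists>g \<in> ring_iso SbarRbar RbarSbar. \<forall>x \<in> carrier Rbar.
      g (left_localization_map Rbar Sbar x) = k x" if S: "S \<in> Den_l R \<aa>" "S \<in> Den_r R \<aa>"
  proof -
    \<comment> \<open>This is the left Ore condition in \<open>Rbar\<close>. It rewrites the right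
      fractions of \<open>RbarSbar\<close> as left ones, so uniqueness of left fractions applies
      here too.\<close>
    have "right_ore_set (opposite_ring Rbar) Sbar"
      using den_l(1)[OF S(1)] unfolding left_denominator_set_def by simp
    then have "left_fractions Rbar RbarSbar k Sbar"
      using left_fractions_opposite_ring[OF RbarSbar[OF S(2)]] by simp
    then show ?thesis by (rule left_fractions_iso[OF SbarRbar[OF S(1)]])
  qed
  have Den: "S \<in> Den R \<aa> \<longleftrightarrow> S \<in> Den_l R \<aa> \<and> S \<in> Den_r R \<aa>"
    unfolding Den_def by simp
  have part1_left: "left_euclidean_ring R d \<and> S \<in> Den R \<aa> \<longrightarrow>
        left_euclidean_ring Rbar dbar \<and>
        ((\<forall>s \<in> Sbar. \<forall>r \<in> carrier Rbar - {\<zero>\<^bsub>Rbar\<^esub>}.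
            dbar (s \<otimes>\<^bsub>Rbar\<^esub> r) = dbar r \<and> dbar (r \<otimes>\<^bsub>Rbar\<^esub> s) = dbar r) \<longrightarrow>
          (\<exists>f \<in> ring_iso SR SbarRbar. \<forall>r \<in> carrier R.
             f (left_localization_map R S r) = left_localization_map Rbar Sbar (\<pi> r)) \<and>
          (\<exists>g \<in> ring_iso SbarRbar RbarSbar. \<forall>x \<in> carrier Rbar.
             g (left_localization_map Rbar Sbar x) = k x) \<and>
          (\<exists>\<delta> :: ('a \<times> 'a) set \<Rightarrow> 'p. \<forall>s \<in> Sbar. \<forall>r \<in> carrier Rbar - {\<zero>\<^bsub>Rbar\<^esub>}.
             \<delta> (left_fraction SR j s r) = dbar r) \<and>
          (\<forall>\<delta> :: ('a \<times> 'a) set \<Rightarrow> 'p.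
             (\<forall>s \<in> Sbar. \<forall>r \<in> carrier Rbar - {\<zero>\<^bsub>Rbar\<^esub>}.
                \<delta> (left_fraction SR j s r) = dbar r) \<longrightarrow>
             left_euclidean_ring SR \<delta> \<and>
             (\<forall>s \<in> Sbar. \<forall>r \<in> carrier Rbar - {\<zero>\<^bsub>Rbar\<^esub>}.
                \<delta> (right_fraction SR j r s) = dbar r)))"
    (is "_ \<longrightarrow> _ \<and> (?inv \<longrightarrow> ?iso1 \<and> ?iso2 \<and> ?ex \<and> ?all)")
  proof (rule impI, elim conjE)
    assume e: "left_euclidean_ring R d" and "S \<in> Den R \<aa>"
    then have S: "S \<in> Den_l R \<aa>" "S \<in> Den_r R \<aa>" using Den by simp_all
    show "left_euclidean_ring Rbar dbar \<and> (?inv \<longrightarrow> ?iso1 \<and> ?iso2 \<and> ?ex \<and> ?all)"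
    proof (rule conjI[OF quot_l[OF e]], rule impI)
      assume ?inv
      then have "?ex \<and> ?all"
        by (intro two_sided_euclidean_fractions[OF SR[OF S(1)] ore_r[OF S(2)] _ quot_l[OF e]]) simp
      then show "?iso1 \<and> ?iso2 \<and> ?ex \<and> ?all"
        by (rule conjI[OF iso1[OF S(1)] conjI[OF iso2[OF S]]])
    qed
  qed
  have part1_right: "right_euclidean_ring R d \<and> S \<in> Den R \<aa> \<longrightarrow>
        right_euclidean_ring Rbar dbar \<and>
        ((\<forall>s \<in> Sbar. \<forall>r \<in> carrier Rbar - {\<zero>\<^bsub>Rbar\<^esub>}.
            dbar (s \<otimes>\<^bsub>Rbar\<^esub> r) = dbar r \<and> dbar (r \<otimes>\<^bsub>Rbar\<^esub> s) = dbar r) \<longrightarrow>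
          (\<exists>f \<in> ring_iso SR SbarRbar. \<forall>r \<in> carrier R.
             f (left_localization_map R S r) = left_localization_map Rbar Sbar (\<pi> r)) \<and>
          (\<exists>g \<in> ring_iso SbarRbar RbarSbar. \<forall>x \<in> carrier Rbar.
             g (left_localization_map Rbar Sbar x) = k x) \<and>
          (\<exists>\<delta> :: ('a \<times> 'a) set \<Rightarrow> 'p. \<forall>s \<in> Sbar. \<forall>r \<in> carrier Rbar - {\<zero>\<^bsub>Rbar\<^esub>}.
             \<delta> (right_fraction SR j r s) = dbar r) \<and>
          (\<forall>\<delta> :: ('a \<times> 'a) set \<Rightarrow> 'p.
             (\<forall>s \<in> Sbar. \<forall>r \<in> carrier Rbar - {\<zero>\<^bsub>Rbar\<^esub>}.
                \<delta> (right_fraction SR j r s) = dbar r) \<longrightarrow>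
             right_euclidean_ring SR \<delta> \<and>
             (\<forall>s \<in> Sbar. \<forall>r \<in> carrier Rbar - {\<zero>\<^bsub>Rbar\<^esub>}.
                \<delta> (left_fraction SR j s r) = dbar r)))"
    (is "_ \<longrightarrow> _ \<and> (?inv \<longrightarrow> ?iso1 \<and> ?iso2 \<and> ?ex \<and> ?all)")
  proof (rule impI, elim conjE)
    assume e: "right_euclidean_ring R d" and "S \<in> Den R \<aa>"
    then have S: "S \<in> Den_l R \<aa>" "S \<in> Den_r R \<aa>" using Den by simp_all
    interpret SR: left_fractions Rbar SR j Sbar by (rule SR[OF S(1)])
    \<comment> \<open>In the opposite of \<open>SR\<close> the two kinds of fractions trade places,
      so the left-handed result there starts from the formula for \<delta> on right
      fractions.\<close>
    have fr: "left_fractions (opposite_ring Rbar) (opposite_ring SR) j Sbar"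
      by (rule left_fractions_opposite_ring[OF SR[OF S(1)] ore_r[OF S(2)]])
    have ore: "right_ore_set (opposite_ring Rbar) Sbar"
      using SR.ore_set by simp
    have eo: "left_euclidean_ring (opposite_ring Rbar) dbar"
      using quot_r[OF e] unfolding right_euclidean_ring_opposite_ring[OF Rbar] .
    show "right_euclidean_ring Rbar dbar \<and> (?inv \<longrightarrow> ?iso1 \<and> ?iso2 \<and> ?ex \<and> ?all)"
    proof (rule conjI[OF quot_r[OF e]], rule impI)
      assume ?inv
      then have inv: "dbar (s \<otimes>\<^bsub>opposite_ring Rbar\<^esub> r) = dbar r \<and> dbar (r \<otimes>\<^bsub>opposite_ring Rbar\<^esub> s) = dbar r"
        if "s \<in> Sbar" "r \<in> carrier (opposite_ring Rbar) - {\<zero>\<^bsub>opposite_ring Rbar\<^esub>}" for s r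
        using that by simp
      have "?ex \<and> ?all"
        using two_sided_euclidean_fractions[OF fr ore inv eo]
        unfolding right_euclidean_ring_opposite_ring[OF SR.hom.S.ring_axioms] by simp
      then show "?iso1 \<and> ?iso2 \<and> ?ex \<and> ?all"
        by (rule conjI[OF iso1[OF S(1)] conjI[OF iso2[OF S]]])
    qed
  qed
  have part2: "left_euclidean_ring R d \<and> S \<in> Den_l R \<aa> \<longrightarrow>
        left_euclidean_ring Rbar dbar \<and>
        (right_saturated Rbar Sbar SR j \<and>
         (\<forall>s \<in> Sbar. \<forall>r \<in> carrier Rbar - {\<zero>\<^bsub>Rbar\<^esub>}. dbar (s \<otimes>\<^bsub>Rbar\<^esub> r) = dbar r) \<longrightarrow>
          (\<exists>\<delta> :: ('a \<times> 'a) set \<Rightarrow> 'p. \<forall>s \<in> Sbar. \<forall>r \<in> carrier Rbar - {\<zero>\<^bsub>Rbar\<^esub>}.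
             \<delta> (left_fraction SR j s r) = dbar r) \<and>
          (\<forall>\<delta> :: ('a \<times> 'a) set \<Rightarrow> 'p.
             (\<forall>s \<in> Sbar. \<forall>r \<in> carrier Rbar - {\<zero>\<^bsub>Rbar\<^esub>}.
                \<delta> (left_fraction SR j s r) = dbar r) \<longrightarrow>
             left_euclidean_ring SR \<delta>))"
    (is "_ \<longrightarrow> _ \<and> (?sat \<and> ?inv \<longrightarrow> ?concl)")
  proof (rule impI, elim conjE)
    assume e: "left_euclidean_ring R d" and S: "S \<in> Den_l R \<aa>"
    show "left_euclidean_ring Rbar dbar \<and> (?sat \<and> ?inv \<longrightarrow> ?concl)"
    proof (rule conjI[OF quot_l[OF e]], rule impI, elim conjE)
      assume ?sat ?inv
      then show ?concl
        by (intro saturated_euclidean_fractions[OF SR[OF S] _ _ quot_l[OF e]]) simp_all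
    qed
  qed
  have part3: "right_euclidean_ring R d \<and> S \<in> Den_r R \<aa> \<longrightarrow>
        right_euclidean_ring Rbar dbar \<and>
        (left_saturated Rbar Sbar RbarSbar k \<and>
         (\<forall>s \<in> Sbar. \<forall>r \<in> carrier Rbar - {\<zero>\<^bsub>Rbar\<^esub>}. dbar (r \<otimes>\<^bsub>Rbar\<^esub> s) = dbar r) \<longrightarrow>
          (\<exists>\<delta> :: ('a set \<times> 'a set) set \<Rightarrow> 'p. \<forall>s \<in> Sbar. \<forall>r \<in> carrier Rbar - {\<zero>\<^bsub>Rbar\<^esub>}.
             \<delta> (right_fraction RbarSbar k r s) = dbar r) \<and>
          (\<forall>\<delta> :: ('a set \<times> 'a set) set \<Rightarrow> 'p.
             (\<forall>s \<in> Sbar. \<forall>r \<in> carrier Rbar - {\<zero>\<^bsub>Rbar\<^esub>}.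
                \<delta> (right_fraction RbarSbar k r s) = dbar r) \<longrightarrow>
             right_euclidean_ring RbarSbar \<delta>))"
    (is "_ \<longrightarrow> _ \<and> (?sat \<and> ?inv \<longrightarrow> ?concl)")
  proof (rule impI, elim conjE)
    assume e: "right_euclidean_ring R d" and S: "S \<in> Den_r R \<aa>"
    interpret Q: left_fractions "opposite_ring Rbar" "opposite_ring RbarSbar" k Sbar
      by (rule RbarSbar[OF S])
    have Q: "ring RbarSbar" using opp_ring[OF Q.hom.S.ring_axioms] by simp
    have eo: "left_euclidean_ring (opposite_ring Rbar) dbar"
      using quot_r[OF e] unfolding right_euclidean_ring_opposite_ring[OF Rbar] .
    show "right_euclidean_ring Rbar dbar \<and> (?sat \<and> ?inv \<longrightarrow> ?concl)"
    proof (rule conjI[OF quot_r[OF e]], rule impI, elim conjE)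
      assume sat: ?sat and ?inv
      then have inv: "dbar (s \<otimes>\<^bsub>opposite_ring Rbar\<^esub> r) = dbar r"
        if "s \<in> Sbar" "r \<in> carrier (opposite_ring Rbar) - {\<zero>\<^bsub>opposite_ring Rbar\<^esub>}" for s r
        using that by simp
      \<comment> \<open>A fraction \<open>t^-1 s\<close> becomes a right fraction in the opposite
        ring, so left saturation turns into right saturation there.\<close>
      have "right_saturated (opposite_ring Rbar) Sbar (opposite_ring RbarSbar) k"
        using sat by simp
      then show ?concl
        using saturated_euclidean_fractions[OF RbarSbar[OF S] _ inv eo]
        unfolding right_euclidean_ring_opposite_ring[OF Q] by simp
    qed
  qed
  show ?thesis using part1_left part1_right part2 part3 by (intro conjI)
qed

end
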